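(* Let $o$ be a $\lambda\mu$-object. The following are equivalent: (i) $o$ is typable in system $\mathcal{H}_{\lambda\mu}$; (ii) $o$ is head-normalizing, i.e. $o\to^{*} o'$ for some head-normal form $o'$; (iii) the head-reduction strategy terminates on $o$. Moreover, if $\Pi$ is an $\mathcal{H}_{\lambda\mu}$ derivation typing $o$, then $\mathrm{sz}(\Pi)$ is an upper bound on the length of the head-reduction sequence starting at $o$.
   Context: The $\lambda\mu$-calculus. Fix countably infinite sets of variables $x,y,\dots$ and names $\alpha,\beta,\gamma,\dots$. Terms $t,u ::= x \mid \lambda x.t \mid t\,u \mid \mu\alpha.c$; commands $c ::= [\alpha]t$; objects $o ::= t \mid c$. $\lambda x$ binds $x$, $\mu\alpha$ binds $\alpha$; $\mathrm{fv}(o)$ and $\mathrm{fn}(o)$ are the free variables and free names (with $\mathrm{fn}([\alpha]t)=\mathrm{fn}(t)\cup\{\alpha\}$); objects are identified up to renaming of bound variables and names. $o\{x/u\}$ is capture-avoiding substitution. The replacement $o\{\alpha/\!\!/u\}$ (capture-avoiding) is defined by $x\{\alpha/\!\!/u\}=x$, homomorphically on $\lambda$-abstraction, application and $\mu\gamma$, $([\gamma]t)\{\alpha/\!\!/u\}=[\gamma](t\{\alpha/\!\!/u\})$ for $\gamma\neq\alpha$, and $([\alpha]t)\{\alpha/\!\!/u\}=[\alpha]((t\{\alpha/\!\!/u\})\,u)$. Reduction $\to$ is the closure under all contexts of $(\lambda x.t)u\to t\{x/u\}$ and $(\mu\alpha.c)u\to \mu\alpha.(c\{\alpha/\!\!/u\})$;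 redexes are terms $(\lambda x.t)u$ and $(\mu\alpha.c)u$. Head contexts: $\mathtt{HT} ::= \Box\,t_1\dots t_n\ (n\ge 0) \mid \lambda x.\mathtt{HT} \mid \mu\alpha.\mathtt{HC}$, $\mathtt{HC} ::= [\alpha]\mathtt{HT}$, $\mathtt{HO}::=\mathtt{HT}\mid\mathtt{HC}$. A head-normal form is an object $\mathtt{HO}[x]$ for a variable $x$. In an object $\mathtt{HO}[r]$ with $r$ a redex, $r$ is the head redex, and contracting it is a head-reduction step; the head-reduction strategy always performs head-reduction steps and stops on head-normal forms. Types: base types $a,b,\dots$; types $\sigma ::= a \mid \mathcal{I}\Rightarrow\mathcal{U}$; union types $\mathcal{U}=\langle\sigma_k\rangle_{k\in K}$ are finite multisets of types; intersection types $\mathcal{I}=[\mathcal{U}_k]_{k\in K}$ are finite multisets of union types; object types are union types or the constant $\#$. Blind types: $\xi ::= a \mid [\,]\Rightarrow\langle\xi\rangle$. $\wedge$ (on intersection types) and $\vee$ (on union types) are multiset union. Choice: $\mathcal{U}^{*}=\mathcal{U}$ if $\mathcal{U}\neq\langle\,\rangle$, and $\langle\,\rangle^{*}$ is $\langle\xi\rangle$ for an arbitrary blind type $\xi$. Arity: $\mathrm{ar}(a)=0$, $\mathrm{ar}(\mathcal{I}\Rightarrow\mathcal{U})=\mathrm{ar}(\mathcal{U})+1$, $\mathrm{ar}(\langle\sigma_k\rangle_{k\in K})=\sum_k\mathrm{ar}(\sigma_k)$. A variable assignment $\Gamma$ maps variables to intersection types ($\mathrm{dom}\,\Gamma$ =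 variables with non-empty image), a name assignment $\Delta$ maps names to union types ($\mathrm{dom}\,\Delta$ = names with non-empty image); $\Gamma\wedge\Gamma'$ and $\Delta\vee\Delta'$ are pointwise; $\Gamma;\Gamma'$ (resp. $\Delta;\Delta'$) denotes this when domains are disjoint; $x:\mathcal{I}$, $\alpha:\mathcal{U}$ are singleton assignments; $\Gamma\setminus x$, $\Delta\setminus\alpha$ set that entry to empty. System $\mathcal{H}_{\lambda\mu}$ has regular judgments $\Gamma\vdash o:\mathcal{A}\mid\Delta$ and auxiliary judgments $\Gamma\Vdash t:\mathcal{I}\mid\Delta$, with rules: (ax) $x:[\mathcal{U}]\vdash x:\mathcal{U}\mid\emptyset$ if $\mathcal{U}\neq\langle\,\rangle$; ($\Rightarrow_i$) from $\Gamma\vdash t:\mathcal{U}\mid\Delta$ infer $\Gamma\setminus x\vdash\lambda x.t:\langle\Gamma(x)\Rightarrow\mathcal{U}\rangle\mid\Delta$; ($\#_i$) from $\Gamma\vdash t:\mathcal{U}\mid\Delta$ infer $\Gamma\vdash[\alpha]t:\#\mid\Delta\vee\{\alpha:\mathcal{U}\}$; ($\#_e$) from $\Gamma\vdash c:\#\mid\Delta$ infer $\Gamma\vdash\mu\alpha.c:(\Delta(\alpha))^{*}\mid\Delta\setminus\alpha$; ($\wedge$) from $(\Gamma_k\vdash t:\mathcal{U}_k\mid\Delta_k)_{k\in K}$ ($K$ possibly empty) infer $\wedge_k\Gamma_k\Vdash t:[\mathcal{U}_k]_{k\in K}\mid\vee_k\Delta_k$; ($\Rightarrow_e$) from $\Gamma_t\vdash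 t:\langle\mathcal{I}_k\Rightarrow\mathcal{U}_k\rangle_{k\in K}\mid\Delta_t$ and $\Gamma_u\Vdash u:\wedge_{k}\mathcal{I}_k\mid\Delta_u$ infer $\Gamma_t\wedge\Gamma_u\vdash t\,u:\vee_k\mathcal{U}_k\mid\Delta_t\vee\Delta_u$. An object is typable if some regular judgment about it is derivable. Size $\mathrm{sz}$ of derivations: (ax) has size 1; ($\Rightarrow_i$) and ($\#_e$) add 1 to the premise; ($\#_i$) adds $\mathrm{ar}(\mathcal{U})$; ($\wedge$) is the sum of the premises; ($\Rightarrow_e$) is the sum of the premises plus $|K|$.
   Formalization: In the formal system, types I⇒U must have U≠⟨⟩ at every depth; with ⟨⟩ allowed as a target the size bound fails: for x of type ⟨[]⇒⟨⟩⟩, (μα.[α]x)u t1…tn is typable with size 4 but takes n+1 head steps. *)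

theory Defs
  imports "HOL-Library.Multiset"
begin

section \<open>The lambda-mu-calculus\<close>

text \<open>
  Objects modulo renaming of bound variables and names are represented with de Bruijn indices,
  with two independent index spaces: \<open>Lam\<close> binds the variable 0 and \<open>Mu\<close> binds the name 0 of its
  body. An index that points beyond all enclosing binders of its kind is a free variable (or name).
\<close>

datatype trm = Var nat | Lam trm | App trm trm | Mu cmd
  and cmd = Named nat trm

datatype obj = Term trm | Command cmd

text \<open>
  \<open>shift_var k\<close> and \<open>shift_name k\<close> increment all free variables (names) with index at least \<open>k\<close>;
  they are what makes substitution and replacement capture-avoiding.
\<close>

primrec shift_var :: "nat \<Rightarrow> trm \<Rightarrow> trm" and shift_var_cmd :: "nat \<Rightarrow> cmd \<Rightarrow> cmd" where
  "shift_var k (Var x) = Var (if x < k then x else Suc x)"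
| "shift_var k (Lam t) = Lam (shift_var (Suc k) t)"
| "shift_var k (App t u) = App (shift_var k t) (shift_var k u)"
| "shift_var k (Mu c) = Mu (shift_var_cmd k c)"
| "shift_var_cmd k (Named a t) = Named a (shift_var k t)"

primrec shift_name :: "nat \<Rightarrow> trm \<Rightarrow> trm" and shift_name_cmd :: "nat \<Rightarrow> cmd \<Rightarrow> cmd" where
  "shift_name k (Var x) = Var x"
| "shift_name k (Lam t) = Lam (shift_name k t)"
| "shift_name k (App t u) = App (shift_name k t) (shift_name k u)"
| "shift_name k (Mu c) = Mu (shift_name_cmd (Suc k) c)"
| "shift_name_cmd k (Named a t) = Named (if a < k then a else Suc a) (shift_name k t)"

text \<open>
  \<open>subst t k u\<close> is the substitution of \<open>u\<close> for the variable \<open>k\<close> in \<open>t\<close>. It is only used to open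
  a \<open>Lam\<close>, so the variables above \<open>k\<close> are decremented.
\<close>

primrec subst :: "trm \<Rightarrow> nat \<Rightarrow> trm \<Rightarrow> trm" and subst_cmd :: "cmd \<Rightarrow> nat \<Rightarrow> trm \<Rightarrow> cmd" where
  "subst (Var x) k u = (if x < k then Var x else if x = k then u else Var (x - 1))"
| "subst (Lam t) k u = Lam (subst t (Suc k) (shift_var 0 u))"
| "subst (App t v) k u = App (subst t k u) (subst v k u)"
| "subst (Mu c) k u = Mu (subst_cmd c k (shift_name 0 u))"
| "subst_cmd (Named a t) k u = Named a (subst t k u)"

text \<open>
  \<open>replace t k u\<close> replaces every subcommand \<open>[k]v\<close> by \<open>[k](v u)\<close>. In contrast to \<open>subst\<close>, the
  name \<open>k\<close> persists, so no index is decremented.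
\<close>

primrec replace :: "trm \<Rightarrow> nat \<Rightarrow> trm \<Rightarrow> trm" and replace_cmd :: "cmd \<Rightarrow> nat \<Rightarrow> trm \<Rightarrow> cmd" where
  "replace (Var x) k u = Var x"
| "replace (Lam t) k u = Lam (replace t k (shift_var 0 u))"
| "replace (App t v) k u = App (replace t k u) (replace v k u)"
| "replace (Mu c) k u = Mu (replace_cmd c (Suc k) (shift_name 0 u))"
| "replace_cmd (Named a t) k u =
     Named a (if a = k then App (replace t k u) u else replace t k u)"

inductive contract :: "trm \<Rightarrow> trm \<Rightarrow> bool" where
  contract_beta: "contract (App (Lam t) u) (subst t 0 u)"
| contract_mu: "contract (App (Mu c) u) (Mu (replace_cmd c 0 (shift_name 0 u)))"

inductive step_trm :: "trm \<Rightarrow> trm \<Rightarrow> bool" and step_cmd :: "cmd \<Rightarrow> cmd \<Rightarrow> bool" where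
  step_contract: "contract r r' \<Longrightarrow> step_trm r r'"
| step_Lam: "step_trm t t' \<Longrightarrow> step_trm (Lam t) (Lam t')"
| step_App_left: "step_trm t t' \<Longrightarrow> step_trm (App t u) (App t' u)"
| step_App_right: "step_trm u u' \<Longrightarrow> step_trm (App t u) (App t u')"
| step_Mu: "step_cmd c c' \<Longrightarrow> step_trm (Mu c) (Mu c')"
| step_Named: "step_trm t t' \<Longrightarrow> step_cmd (Named a t) (Named a t')"

inductive step :: "obj \<Rightarrow> obj \<Rightarrow> bool" where
  step_Term: "step_trm t t' \<Longrightarrow> step (Term t) (Term t')"
| step_Command: "step_cmd c c' \<Longrightarrow> step (Command c) (Command c')"

section \<open>Head reduction\<close>

text \<open>
  Filling a hole is purely textual: the binders of the context capture the free indices of the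
  inserted term, so no shifting takes place.
\<close>

datatype ht_ctx = HHole "trm list" | HLam ht_ctx | HMu hc_ctx
  and hc_ctx = HNamed nat ht_ctx

datatype ho_ctx = HTerm ht_ctx | HCommand hc_ctx

primrec fill_ht :: "ht_ctx \<Rightarrow> trm \<Rightarrow> trm" and fill_hc :: "hc_ctx \<Rightarrow> trm \<Rightarrow> cmd" where
  "fill_ht (HHole ts) r = foldl App r ts"
| "fill_ht (HLam H) r = Lam (fill_ht H r)"
| "fill_ht (HMu C) r = Mu (fill_hc C r)"
| "fill_hc (HNamed a H) r = Named a (fill_ht H r)"

primrec fill :: "ho_ctx \<Rightarrow> trm \<Rightarrow> obj" where
  "fill (HTerm H) r = Term (fill_ht H r)"
| "fill (HCommand C) r = Command (fill_hc C r)"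

definition head_normal :: "obj \<Rightarrow> bool" where
  "head_normal ob \<longleftrightarrow> (\<exists>H x. ob = fill H (Var x))"

inductive head_step :: "obj \<Rightarrow> obj \<Rightarrow> bool" where
  "contract r r' \<Longrightarrow> head_step (fill H r) (fill H r')"

definition head_normalizing :: "obj \<Rightarrow> bool" where
  "head_normalizing ob \<longleftrightarrow> (\<exists>ob'. step\<^sup>*\<^sup>* ob ob' \<and> head_normal ob')"

definition head_strategy_terminates :: "obj \<Rightarrow> bool" where
  "head_strategy_terminates ob \<longleftrightarrow>
     \<not> (\<exists>f :: nat \<Rightarrow> obj. f 0 = ob \<and> (\<forall>i. head_step (f i) (f (Suc i))))"

section \<open>Types\<close>

datatype ty = Base nat | Arrow "ty multiset multiset" "ty multiset"

type_synonym union_ty = "ty multiset"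
type_synonym inter_ty = "ty multiset multiset"

datatype obj_ty = UnionTy union_ty | Hash

text \<open>
  The target of an arrow type has to be a non-empty union type, at every depth. This is what makes
  \<open>\<langle>\<rangle>\<close> unassignable to terms, as intended by the side condition of the axiom rule and by the choice
  operator. If \<open>\<tau> = [] \<Rightarrow> \<langle>\<rangle>\<close> were admitted, then from \<open>x : [\<langle>\<tau>\<rangle>]\<close> one could derive the type
  \<open>\<langle>\<rangle>\<close> for \<open>(\<mu>\<alpha>. [\<alpha>]x) u t\<^sub>1 \<dots> t\<^sub>n\<close> with size 4 (the last \<open>n\<close> applications having
  \<open>K = \<emptyset>\<close>), whereas the head-reduction sequence of this term has length \<open>n + 1\<close>.
\<close>

inductive proper :: "ty \<Rightarrow> bool" where
  proper_Base: "proper (Base a)"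
| proper_Arrow: "\<lbrakk>\<And>U \<sigma>. U \<in># I \<Longrightarrow> \<sigma> \<in># U \<Longrightarrow> proper \<sigma>;
    V \<noteq> {#}; \<And>\<sigma>. \<sigma> \<in># V \<Longrightarrow> proper \<sigma>\<rbrakk> \<Longrightarrow> proper (Arrow I V)"

inductive blind :: "ty \<Rightarrow> bool" where
  blind_Base: "blind (Base a)"
| blind_Arrow: "blind \<xi> \<Longrightarrow> blind (Arrow {#} {#\<xi>#})"

text \<open>The choice operator is non-deterministic, hence a relation.\<close>

inductive choice :: "union_ty \<Rightarrow> union_ty \<Rightarrow> bool" where
  choice_nonempty: "U \<noteq> {#} \<Longrightarrow> choice U U"
| choice_empty: "blind \<xi> \<Longrightarrow> choice {#} {#\<xi>#}"

primrec arity_ty :: "ty \<Rightarrow> nat" where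
  "arity_ty (Base a) = 0"
| "arity_ty (Arrow I U) = \<Sum>\<^sub># (image_mset arity_ty U) + 1"

definition arity :: "union_ty \<Rightarrow> nat" where
  "arity U = \<Sum>\<^sub># (image_mset arity_ty U)"

section \<open>The typing system\<close>

type_synonym var_assignment = "nat \<Rightarrow> inter_ty"
type_synonym name_assignment = "nat \<Rightarrow> union_ty"

text \<open>
  \<open>regular \<Gamma> ob A \<Delta> n\<close> says that there is a derivation of size \<open>n\<close> of the regular judgment
  \<open>\<Gamma> \<turnstile> ob : A | \<Delta>\<close>; likewise \<open>auxiliary \<Gamma> t I \<Delta> n\<close> for \<open>\<Gamma> \<tturnstile> t : I | \<Delta>\<close>.
  As index 0 denotes the bound variable (name) of the body of a binder, removing it from an
  assignment means moving all other entries down by one.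

  Demanding \<open>proper\<close> types in the axiom rule is enough: blind types are proper, and the other rules
  only yield proper types, with non-empty union types for terms, from such types.
\<close>

inductive regular ::
    "var_assignment \<Rightarrow> obj \<Rightarrow> obj_ty \<Rightarrow> name_assignment \<Rightarrow> nat \<Rightarrow> bool"
  and auxiliary ::
    "var_assignment \<Rightarrow> trm \<Rightarrow> inter_ty \<Rightarrow> name_assignment \<Rightarrow> nat \<Rightarrow> bool"
where
  ax: "\<lbrakk>U \<noteq> {#}; \<And>\<sigma>. \<sigma> \<in># U \<Longrightarrow> proper \<sigma>\<rbrakk> \<Longrightarrow>
    regular ((\<lambda>_. {#})(x := {#U#})) (Term (Var x)) (UnionTy U) (\<lambda>_. {#}) 1"
| arrow_intro: "regular \<Gamma> (Term t) (UnionTy U) \<Delta> n \<Longrightarrow>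
    regular (\<lambda>x. \<Gamma> (Suc x)) (Term (Lam t)) (UnionTy {#Arrow (\<Gamma> 0) U#}) \<Delta> (n + 1)"
| hash_intro: "regular \<Gamma> (Term t) (UnionTy U) \<Delta> n \<Longrightarrow>
    regular \<Gamma> (Command (Named a t)) Hash (\<Delta>(a := \<Delta> a + U)) (n + arity U)"
| hash_elim: "\<lbrakk>regular \<Gamma> (Command c) Hash \<Delta> n; choice (\<Delta> 0) V\<rbrakk> \<Longrightarrow>
    regular \<Gamma> (Term (Mu c)) (UnionTy V) (\<lambda>a. \<Delta> (Suc a)) (n + 1)"
| wedge: "\<lbrakk>finite (K :: nat set);
      \<And>k. k \<in> K \<Longrightarrow> regular (\<Gamma> k) (Term t) (UnionTy (U k)) (\<Delta> k) (n k)\<rbrakk> \<Longrightarrow>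
    auxiliary (\<lambda>x. \<Sum>k\<in>K. \<Gamma> k x) t (image_mset U (mset_set K)) (\<lambda>a. \<Sum>k\<in>K. \<Delta> k a)
      (\<Sum>k\<in>K. n k)"
| arrow_elim: "\<lbrakk>finite (K :: nat set);
      regular \<Gamma>\<^sub>t (Term t) (UnionTy (image_mset (\<lambda>k. Arrow (I k) (U k)) (mset_set K))) \<Delta>\<^sub>t n;
      auxiliary \<Gamma>\<^sub>u u (\<Sum>k\<in>K. I k) \<Delta>\<^sub>u m\<rbrakk> \<Longrightarrow>
    regular (\<lambda>x. \<Gamma>\<^sub>t x + \<Gamma>\<^sub>u x) (Term (App t u)) (UnionTy (\<Sum>k\<in>K. U k)) (\<lambda>a. \<Delta>\<^sub>t a + \<Delta>\<^sub>u a)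
      (n + m + card K)"

definition typable :: "obj \<Rightarrow> bool" where
  "typable ob \<longleftrightarrow> (\<exists>\<Gamma> A \<Delta> n. regular \<Gamma> ob A \<Delta> n)"

end

theory Submission
  imports Defs "HOL-Library.Function_Algebras" "HOL-Library.Product_Plus"
begin

text \<open>
  The typing rules are syntax-directed, so that \<open>derives t U (\<Gamma>, \<Delta>, n)\<close> can be defined by recursion
  on \<open>t\<close>, and a triple \<open>(\<Gamma>, \<Delta>, n)\<close> of assignments and cost is treated as a single element of a
  commutative monoid. Multisets of types record exactly how often an argument is used, hence
  substitution and replacement satisfy equivalences: a derivation for \<open>t{x/u}\<close> or \<open>t{\<alpha>//u}\<close> is the
  same as a derivation for \<open>t\<close> together with one derivation for \<open>u\<close> for each of its uses, with equal
  cost. This needs axioms to be free of charge, unlike in \<open>sz\<close>; binders are free as well. This is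
  harmless, since a smaller cost gives a sharper bound. The two directions of the equivalences yield, respectively, subject reduction
  where contracting a typed redex strictly lowers the cost, and subject expansion. A head redex is
  never inside an argument, so it is typed and the cost bounds the number of head steps; conversely,
  head-normal forms are typable by giving the head variable a blind type, and subject
  expansion propagates typability backwards.
\<close>

declare split_paired_Ex [simp del] split_paired_All [simp del]

section \<open>Environments\<close>

type_synonym env = "var_assignment \<times> name_assignment \<times> nat"

definition single :: "nat \<Rightarrow> 'a \<Rightarrow> nat \<Rightarrow> 'a::zero" where
  "single x v = (\<lambda>y. if y = x then v else 0)"

text \<open>The counterpart for assignments of \<open>shift_var k\<close> and
  \<open>shift_name k\<close>: the fresh index \<open>k\<close> receives the empty multiset.
  Likewise \<open>delete_at\<close> mirrors the decrement performed by \<open>subst\<close>.\<close>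

definition insert_zero :: "nat \<Rightarrow> (nat \<Rightarrow> 'a) \<Rightarrow> nat \<Rightarrow> 'a::zero" where
  "insert_zero k f = (\<lambda>i. if i < k then f i else if i = k then 0 else f (i - 1))"

definition delete_at :: "nat \<Rightarrow> (nat \<Rightarrow> 'a) \<Rightarrow> nat \<Rightarrow> 'a" where
  "delete_at k f = (\<lambda>i. if i < k then f i else f (Suc i))"

definition cost :: "nat \<Rightarrow> env" where
  "cost s = (0, 0, s)"

definition label :: "nat \<Rightarrow> union_ty \<Rightarrow> nat \<Rightarrow> env" where
  "label a U s = (0, single a U, s)"

text \<open>Binders are read from the conclusion upwards: the body's environment is that of the
  conclusion with an entry for index 0 put in front. Every environment has this form
  (\<open>ex_push_var\<close>), so nothing is lost.\<close>

definition push_var :: "inter_ty \<Rightarrow> env \<Rightarrow> env" where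
  "push_var I E = (case_nat I (fst E), snd E)"

definition push_name :: "union_ty \<Rightarrow> env \<Rightarrow> env" where
  "push_name U E = (fst E, case_nat U (fst (snd E)), snd (snd E))"

lemma insert_zero_plus:
  "insert_zero k (f + g) = (insert_zero k f + insert_zero k g :: nat \<Rightarrow> 'a::comm_monoid_add)"
  by (auto simp: insert_zero_def fun_eq_iff)

lemma insert_zero_zero [simp]: "insert_zero k 0 = 0"
  by (auto simp: insert_zero_def fun_eq_iff)

lemma insert_zero_single:
  "insert_zero k (single a v) = single (if a < k then a else Suc a) v"
  by (auto simp: insert_zero_def single_def fun_eq_iff)

lemma insert_zero_case_nat: "insert_zero (Suc k) (case_nat v f) = case_nat v (insert_zero k f)"
  by (auto simp: insert_zero_def fun_eq_iff split: nat.split)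

lemma delete_at_plus:
  "delete_at k (f + g) = (delete_at k f + delete_at k g :: nat \<Rightarrow> 'a::comm_monoid_add)"
  by (auto simp: delete_at_def fun_eq_iff)

lemma delete_at_zero [simp]: "delete_at k 0 = 0"
  by (auto simp: delete_at_def fun_eq_iff)

lemma delete_at_case_nat: "delete_at (Suc k) (case_nat v f) = case_nat v (delete_at k f)"
  by (auto simp: delete_at_def fun_eq_iff split: nat.split)

text \<open>A summand weakened at 0 cannot contribute to the bound index. This is how an argument
  carried under a binder stays clear of the bound variable or name.\<close>

lemma case_nat_plus_insert_zero:
  "case_nat v f = case_nat w g + insert_zero 0 h \<longleftrightarrow>
     v = w \<and> f = (g + h :: nat \<Rightarrow> 'a::comm_monoid_add)"
proof
  assume *: "case_nat v f = case_nat w g + insert_zero 0 h"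
  have "v = w" using fun_cong[OF *, of 0] by (simp add: insert_zero_def)
  moreover have "f i = g i + h i" for i
    using fun_cong[OF *, of "Suc i"] by (simp add: insert_zero_def)
  ultimately show "v = w \<and> f = g + h" by (simp add: fun_eq_iff)
qed (auto simp: insert_zero_def fun_eq_iff split: nat.split)

lemma ex_case_nat: "(\<exists>f. P f) \<longleftrightarrow> (\<exists>v f. P (case_nat v f))"
proof
  assume "\<exists>f. P f"
  then obtain f where "P f" ..
  moreover have "f = case_nat (f 0) (\<lambda>i. f (Suc i))"
    by (auto simp: fun_eq_iff split: nat.split)
  ultimately show "\<exists>v f. P (case_nat v f)" by metis
qed auto

lemma ex_push_var: "(\<exists>E. P E) \<longleftrightarrow> (\<exists>I E. P (push_var I E))"
  unfolding push_var_def split_paired_Ex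
  by (subst ex_case_nat) auto

lemma ex_push_name: "(\<exists>E. P E) \<longleftrightarrow> (\<exists>U E. P (push_name U E))"
  unfolding push_name_def split_paired_Ex
  by (subst ex_case_nat[of "\<lambda>f. \<exists>n. P (_, f, n)"]) auto

section \<open>Gathering derivations\<close>

inductive gather :: "('t \<Rightarrow> 'e \<Rightarrow> bool) \<Rightarrow> 't multiset \<Rightarrow> 'e::comm_monoid_add \<Rightarrow> bool"
  for P where
  gather_empty: "gather P {#} 0"
| gather_add: "P U E \<Longrightarrow> gather P I F \<Longrightarrow> gather P (add_mset U I) (E + F)"

lemma gather_empty_iff [simp]: "gather P {#} E \<longleftrightarrow> E = 0"
  by (auto elim: gather.cases intro: gather.intros)

lemma gather_add_iff:
  "gather P (add_mset U I) E \<longleftrightarrow> (\<exists>E1 E2. P U E1 \<and> gather P I E2 \<and> E = E1 + E2)"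
proof
  show "gather P (add_mset U I) E \<Longrightarrow> \<exists>E1 E2. P U E1 \<and> gather P I E2 \<and> E = E1 + E2"
  proof (induction "add_mset U I" E arbitrary: I rule: gather.induct)
    case (gather_add V E J F)
    show ?case
    proof (cases "V = U")
      case True
      then show ?thesis using gather_add by auto
    next
      case False
      \<comment> \<open>The derivation added last is for \<open>V\<close>, so \<open>U\<close> lies
        in the remainder \<open>J\<close>. The induction hypothesis extracts it there, and the
        derivation for \<open>V\<close> is put back on the other summand.\<close>
      then obtain K where "J = add_mset U K" "I = add_mset V K"
        using gather_add(4) by (metis add_eq_conv_ex)
      moreover from this gather_add(3) obtain F1 F2 where
        "P U F1" "gather P K F2" "F = F1 + F2" by blast
      ultimately show ?thesis
        using gather_add(1) gather.gather_add[of P V E K F2]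
        by (metis add.left_commute)
    qed
  qed simp
qed (auto intro: gather.intros)

lemma gather_plus_iff:
  "gather P (I + J) E \<longleftrightarrow> (\<exists>E1 E2. gather P I E1 \<and> gather P J E2 \<and> E = E1 + E2)"
proof (induction I arbitrary: E)
  case (add U I)
  then show ?case by (auto simp: gather_add_iff) (metis add.assoc)+
qed simp

lemma gather_single_iff [simp]: "gather P {#U#} E \<longleftrightarrow> P U E"
  by (simp add: gather_add_iff)

section \<open>Transport of derivations\<close>

text \<open>
  \<open>P\<close> stands for the derivability of some object \<open>t\<close>, and \<open>Q\<close> for that of an argument \<open>u\<close> inserted
  into \<open>t\<close>. The relation \<open>R E1 E' J\<close> says that the insertion turns the environment \<open>E1\<close> of \<open>t\<close>
  into \<open>E'\<close> and consumes derivations of \<open>u\<close> with the types \<open>J\<close>.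
\<close>

definition transport ::
  "('e \<Rightarrow> 'e \<Rightarrow> 't multiset \<Rightarrow> bool) \<Rightarrow> ('t \<Rightarrow> 'e \<Rightarrow> bool) \<Rightarrow> ('e \<Rightarrow> bool) \<Rightarrow>
   'e::comm_monoid_add \<Rightarrow> bool" where
  "transport R Q P E \<longleftrightarrow> (\<exists>E1 E' J E2. P E1 \<and> R E1 E' J \<and> gather Q J E2 \<and> E = E' + E2)"

text \<open>Both clauses are equivalences, because sums have to be split for expansion-style
  arguments as well as merged for reduction.\<close>

definition additive :: "('e::comm_monoid_add \<Rightarrow> 'e \<Rightarrow> 't multiset \<Rightarrow> bool) \<Rightarrow> bool" where
  "additive R \<longleftrightarrow>
    (\<forall>E J. R 0 E J \<longleftrightarrow> E = 0 \<and> J = {#}) \<and>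
    (\<forall>A B E J. R (A + B) E J \<longleftrightarrow>
       (\<exists>A' B' I1 I2. R A A' I1 \<and> R B B' I2 \<and> E = A' + B' \<and> J = I1 + I2))"

text \<open>The Minkowski sum of two sets of environments. Rules with several premises become sums
  of this kind, so that compatibility with \<open>combine\<close> settles them all.\<close>

definition combine :: "('e \<Rightarrow> bool) \<Rightarrow> ('e \<Rightarrow> bool) \<Rightarrow> 'e::plus \<Rightarrow> bool" where
  "combine P Q E \<longleftrightarrow> (\<exists>A B. P A \<and> Q B \<and> E = A + B)"

lemma combineI: "P A \<Longrightarrow> Q B \<Longrightarrow> combine P Q (A + B)"
  unfolding combine_def by blast

text \<open>Additivity splits the consumed types \<open>J\<close> between the two summands,
  \<open>gather\<close> splits along \<open>J\<close>, and commutativity regroups the resulting four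
  environments.\<close>

lemma transport_combine:
  assumes "additive R"
  shows "transport R Q (combine P1 P2) = combine (transport R Q P1) (transport R Q P2)"
proof (intro ext iffI)
  fix E
  assume "transport R Q (combine P1 P2) E"
  then obtain A B E' J E2 where *: "P1 A" "P2 B" "R (A + B) E' J" "gather Q J E2" "E = E' + E2"
    unfolding transport_def combine_def by blast
  with assms obtain A' B' I1 I2 where
    **: "R A A' I1" "R B B' I2" "E' = A' + B'" "J = I1 + I2"
    unfolding additive_def by blast
  with * obtain F1 F2 where "gather Q I1 F1" "gather Q I2 F2" "E2 = F1 + F2"
    by (auto simp: gather_plus_iff)
  moreover have "E = (A' + F1) + (B' + F2)"
    using * ** calculation by (simp add: ac_simps)
  ultimately show "combine (transport R Q P1) (transport R Q P2) E"
    unfolding transport_def combine_def using * ** by blast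
next
  fix E
  assume "combine (transport R Q P1) (transport R Q P2) E"
  then obtain A A' I1 F1 B B' I2 F2 where *:
    "P1 A" "R A A' I1" "gather Q I1 F1" "P2 B" "R B B' I2" "gather Q I2 F2"
    "E = (A' + F1) + (B' + F2)"
    unfolding transport_def combine_def by blast
  have "R (A + B) (A' + B') (I1 + I2)"
    using assms * unfolding additive_def by blast
  moreover have "gather Q (I1 + I2) (F1 + F2)" using * by (auto simp: gather_plus_iff)
  moreover have "E = (A' + B') + (F1 + F2)" using * by (simp add: ac_simps)
  ultimately show "transport R Q (combine P1 P2) E"
    unfolding transport_def combine_def using * by blast
qed

lemma gather_add_combine: "gather P (add_mset U I) = combine (P U) (gather P I)"
  by (simp add: gather_add_iff combine_def fun_eq_iff)

lemma transport_gather: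
  assumes "additive R"
  shows "gather (\<lambda>U. transport R Q (P U)) I = transport R Q (gather P I)"
proof (induction I)
  case empty
  then show ?case using assms by (auto simp: transport_def additive_def fun_eq_iff)
qed (simp add: gather_add_combine transport_combine[OF assms])

lemma transport_point:
  assumes "\<And>E J. R A E J \<longleftrightarrow> E = B \<and> J = {#}"
  shows "transport R Q (\<lambda>E. E = A) = (\<lambda>E. E = B)"
  by (auto simp: transport_def assms fun_eq_iff)

lemma transport_Ex: "transport R Q (\<lambda>E. \<exists>x. P x E) E \<longleftrightarrow> (\<exists>x. transport R Q (P x) E)"
  unfolding transport_def by blast

lemma transport_conj: "transport R Q (\<lambda>E. a \<and> P E) E \<longleftrightarrow> a \<and> transport R Q P E"
  by (auto simp: transport_def)

section \<open>A syntax-directed presentation of the typing system\<close>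

text \<open>A multiset \<open>M\<close> of source-target pairs takes the place of the family indexed
  by \<open>K\<close> in an application: \<open>arrows M\<close> is demanded of the function,
  \<open>sources M\<close> of the argument, and \<open>targets M\<close> results.\<close>

definition arrows :: "(inter_ty \<times> union_ty) multiset \<Rightarrow> union_ty" where
  "arrows M = image_mset (\<lambda>p. Arrow (fst p) (snd p)) M"

definition sources :: "(inter_ty \<times> union_ty) multiset \<Rightarrow> inter_ty" where
  "sources M = \<Sum>\<^sub># (image_mset fst M)"

definition targets :: "(inter_ty \<times> union_ty) multiset \<Rightarrow> union_ty" where
  "targets M = \<Sum>\<^sub># (image_mset snd M)"

lemma arrows_simps [simp]:
  "arrows {#} = {#}" "arrows (add_mset p M) = add_mset (Arrow (fst p) (snd p)) (arrows M)"
  "arrows (M + N) = arrows M + arrows N"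
  by (simp_all add: arrows_def)

lemma sources_simps [simp]:
  "sources {#} = {#}" "sources (add_mset p M) = fst p + sources M"
  "sources (M + N) = sources M + sources N"
  by (simp_all add: sources_def)

lemma targets_simps [simp]:
  "targets {#} = {#}" "targets (add_mset p M) = snd p + targets M"
  "targets (M + N) = targets M + targets N"
  by (simp_all add: targets_def)

primrec derives :: "trm \<Rightarrow> union_ty \<Rightarrow> env \<Rightarrow> bool"
  and derives_cmd :: "cmd \<Rightarrow> env \<Rightarrow> bool" where
  "derives (Var x) U = (\<lambda>E. U \<noteq> {#} \<and> (\<forall>\<sigma> \<in># U. proper \<sigma>) \<and> E = (single x {#U#}, 0, 0))"
| "derives (Lam t) V = (\<lambda>E. \<exists>I U. V = {#Arrow I U#} \<and> derives t U (push_var I E))"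
| "derives (App t u) V = (\<lambda>E. \<exists>M. V = targets M \<and>
     combine (combine (derives t (arrows M)) (gather (derives u) (sources M)))
       (\<lambda>C. C = cost (size M)) E)"
| "derives (Mu c) V = (\<lambda>E. \<exists>U. choice U V \<and> derives_cmd c (push_name U E))"
| "derives_cmd (Named a t) = (\<lambda>E. \<exists>U. combine (derives t U) (\<lambda>B. B = label a U (arity U)) E)"

text \<open>Shifting, substitution and replacement differ only in \<open>R\<close> and
  \<open>Q\<close>. This lemma and the next three treat their common inductive cases once and for
  all.\<close>

lemma derives_App_transport:
  assumes R: "additive R" and cost: "\<And>s E J. R (cost s) E J \<longleftrightarrow> E = cost s \<and> J = {#}"
    and t: "\<And>U E. derives t' U E \<longleftrightarrow> transport R Q (derives t U) E"
    and u: "\<And>U E. derives u' U E \<longleftrightarrow> transport R Q (derives u U) E"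
  shows "derives (App t' u') V E \<longleftrightarrow> transport R Q (derives (App t u) V) E"
proof -
  have "derives t' = (\<lambda>U. transport R Q (derives t U))" using t by (simp add: fun_eq_iff)
  moreover have "derives u' = (\<lambda>U. transport R Q (derives u U))" using u by (simp add: fun_eq_iff)
  ultimately show ?thesis
    unfolding derives.simps transport_Ex transport_conj transport_combine[OF R]
    by (simp only: transport_gather[OF R] transport_point[where R = R, OF cost])
qed

lemma derives_Lam_transport:
  assumes "\<And>I U. derives t' U (push_var I E) \<longleftrightarrow> transport R Q (\<lambda>E. derives t U (push_var I E)) E"
  shows "derives (Lam t') V E \<longleftrightarrow> transport R Q (derives (Lam t) V) E"
  unfolding derives.simps transport_Ex transport_conj assms ..

lemma derives_Mu_transport:
  assumes "\<And>U. derives_cmd c' (push_name U E) \<longleftrightarrow> transport R Q (\<lambda>E. derives_cmd c (push_name U E)) E"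
  shows "derives (Mu c') V E \<longleftrightarrow> transport R Q (derives (Mu c) V) E"
  unfolding derives.simps transport_Ex transport_conj assms ..

lemma derives_Named_transport:
  assumes R: "additive R"
    and label: "\<And>U E J. R (label a U (arity U)) E J \<longleftrightarrow> E = label b U (arity U) \<and> J = {#}"
    and t: "\<And>U E. derives t' U E \<longleftrightarrow> transport R Q (derives t U) E"
  shows "derives_cmd (Named b t') E \<longleftrightarrow> transport R Q (derives_cmd (Named a t)) E"
proof -
  have "derives t' = (\<lambda>U. transport R Q (derives t U))" using t by (simp add: fun_eq_iff)
  then show ?thesis
    unfolding derives_cmd.simps transport_Ex transport_combine[OF R]
    by (simp only: transport_point[where R = R, OF label])
qed

section \<open>Weakening of environments and transport under binders\<close>

definition weaken_var :: "nat \<Rightarrow> env \<Rightarrow> env" where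
  "weaken_var k E = (insert_zero k (fst E), snd E)"

definition weaken_name :: "nat \<Rightarrow> env \<Rightarrow> env" where
  "weaken_name k E = (fst E, insert_zero k (fst (snd E)), snd (snd E))"

lemma push_var_eq_plus_weaken:
  "push_var I E = push_var J F + weaken_var 0 G \<longleftrightarrow> I = J \<and> E = F + G"
  by (cases E; cases F; cases G)
    (auto simp: push_var_def weaken_var_def case_nat_plus_insert_zero)

lemma push_name_eq_plus_weaken:
  "push_name U E = push_name V F + weaken_name 0 G \<longleftrightarrow> U = V \<and> E = F + G"
  by (cases E; cases F; cases G)
    (auto simp: push_name_def weaken_name_def case_nat_plus_insert_zero)

text \<open>Below the binder the argument is shifted, so by \<open>Q\<close> its derivations have an
  empty entry at 0. The bound entry therefore comes from the body alone and can be stripped on both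
  sides.\<close>

lemma transport_push_var:
  assumes R: "\<And>E1 E J I. R' (push_var I E1) E J \<longleftrightarrow> (\<exists>E'. E = push_var I E' \<and> R E1 E' J)"
    and Q: "\<And>J E. gather Q' J E \<longleftrightarrow> (\<exists>E'. E = weaken_var 0 E' \<and> gather Q J E')"
  shows "transport R' Q' P (push_var I E) \<longleftrightarrow> transport R Q (\<lambda>E. P (push_var I E)) E"
  unfolding transport_def Q ex_push_var[of "\<lambda>E. \<exists>E' J E2. P E \<and> _ E E' J E2"] R
  by (metis push_var_eq_plus_weaken[of I E])

lemma transport_push_name:
  assumes R: "\<And>E1 E J U. R' (push_name U E1) E J \<longleftrightarrow> (\<exists>E'. E = push_name U E' \<and> R E1 E' J)"
    and Q: "\<And>J E. gather Q' J E \<longleftrightarrow> (\<exists>E'. E = weaken_name 0 E' \<and> gather Q J E')"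
  shows "transport R' Q' P (push_name U E) \<longleftrightarrow> transport R Q (\<lambda>E. P (push_name U E)) E"
  unfolding transport_def Q ex_push_name[of "\<lambda>E. \<exists>E' J E2. P E \<and> _ E E' J E2"] R
  by (metis push_name_eq_plus_weaken[of U E])

subsection \<open>Shifting\<close>

text \<open>Shifting is treated as a transport that inserts no argument: \<open>J\<close> is empty
  and \<open>no_derivation\<close> supplies nothing, so the lemmas on transport apply to it
  too.\<close>

definition shift_rel :: "(env \<Rightarrow> env) \<Rightarrow> env \<Rightarrow> env \<Rightarrow> inter_ty \<Rightarrow> bool" where
  "shift_rel f E E' J \<longleftrightarrow> E' = f E \<and> J = {#}"

abbreviation no_derivation :: "union_ty \<Rightarrow> env \<Rightarrow> bool" where
  "no_derivation \<equiv> \<lambda>_ _. False"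

lemma gather_no_derivation [simp]: "gather no_derivation J E \<longleftrightarrow> J = {#} \<and> E = 0"
  by (cases J) (auto simp: gather_add_iff)

lemma transport_shift_rel:
  "transport (shift_rel f) no_derivation P E \<longleftrightarrow> (\<exists>E'. P E' \<and> E = f E')"
  by (auto simp: transport_def shift_rel_def)

lemma weaken_zero [simp]: "weaken_var k 0 = 0" "weaken_name k 0 = 0"
  by (simp_all add: weaken_var_def weaken_name_def zero_prod_def)

lemma weaken_plus:
  "weaken_var k (E + F) = weaken_var k E + weaken_var k F"
  "weaken_name k (E + F) = weaken_name k E + weaken_name k F"
  by (auto simp: weaken_var_def weaken_name_def insert_zero_plus plus_prod_def)

lemma additive_shift_rel:
  "additive (shift_rel (weaken_var k))" "additive (shift_rel (weaken_name k))"
  by (auto simp: additive_def shift_rel_def weaken_plus)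

lemma weaken_push:
  "weaken_var (Suc k) (push_var I E) = push_var I (weaken_var k E)"
  "weaken_var k (push_name U E) = push_name U (weaken_var k E)"
  "weaken_name (Suc k) (push_name U E) = push_name U (weaken_name k E)"
  "weaken_name k (push_var I E) = push_var I (weaken_name k E)"
  by (simp_all add: weaken_var_def weaken_name_def push_var_def push_name_def insert_zero_case_nat)

lemma weaken_cost: "weaken_var k (cost s) = cost s" "weaken_name k (cost s) = cost s"
  by (simp_all add: weaken_var_def weaken_name_def cost_def)

lemma weaken_label:
  "weaken_var k (label a U s) = label a U s"
  "weaken_name k (label a U s) = label (if a < k then a else Suc a) U s"
  by (simp_all add: weaken_var_def weaken_name_def label_def insert_zero_single)

lemma shift_rel_cost:
  "shift_rel (weaken_var k) (cost s) E J \<longleftrightarrow> E = cost s \<and> J = {#}"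
  "shift_rel (weaken_name k) (cost s) E J \<longleftrightarrow> E = cost s \<and> J = {#}"
  by (simp_all add: shift_rel_def weaken_cost)

lemma shift_rel_label:
  "shift_rel (weaken_var k) (label a U s) E J \<longleftrightarrow> E = label a U s \<and> J = {#}"
  "shift_rel (weaken_name k) (label a U s) E J \<longleftrightarrow>
     E = label (if a < k then a else Suc a) U s \<and> J = {#}"
  by (simp_all add: shift_rel_def weaken_label)

lemma shift_rel_push:
  "shift_rel (weaken_var (Suc k)) (push_var I E1) E J \<longleftrightarrow>
     (\<exists>E'. E = push_var I E' \<and> shift_rel (weaken_var k) E1 E' J)"
  "shift_rel (weaken_var k) (push_name U E1) E J \<longleftrightarrow>
     (\<exists>E'. E = push_name U E' \<and> shift_rel (weaken_var k) E1 E' J)"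
  "shift_rel (weaken_name (Suc k)) (push_name U E1) E J \<longleftrightarrow>
     (\<exists>E'. E = push_name U E' \<and> shift_rel (weaken_name k) E1 E' J)"
  "shift_rel (weaken_name k) (push_var I E1) E J \<longleftrightarrow>
     (\<exists>E'. E = push_var I E' \<and> shift_rel (weaken_name k) E1 E' J)"
  by (auto simp: shift_rel_def weaken_push)

lemma gather_no_derivation_weaken:
  "gather no_derivation J E \<longleftrightarrow> (\<exists>E'. E = weaken_var k E' \<and> gather no_derivation J E')"
  "gather no_derivation J E \<longleftrightarrow> (\<exists>E'. E = weaken_name k E' \<and> gather no_derivation J E')"
  by auto

lemma derives_shift_var_transport:
  "derives (shift_var k t) U E \<longleftrightarrow>
     transport (shift_rel (weaken_var k)) no_derivation (derives t U) E"
  "derives_cmd (shift_var_cmd k c) E \<longleftrightarrow>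
     transport (shift_rel (weaken_var k)) no_derivation (derives_cmd c) E"
proof (induction t and c arbitrary: k U E and k E)
  case (Var x)
  show ?case
    by (auto simp: transport_shift_rel weaken_var_def insert_zero_single)
next
  case (Lam t)
  show ?case unfolding shift_var.simps
    by (rule derives_Lam_transport, unfold Lam)
      (rule transport_push_var[OF shift_rel_push(1) gather_no_derivation_weaken(1)])
next
  case (App t u)
  show ?case unfolding shift_var.simps
    by (rule derives_App_transport[OF additive_shift_rel(1) shift_rel_cost(1) App])
next
  case (Mu c)
  show ?case unfolding shift_var.simps
    by (rule derives_Mu_transport, unfold Mu)
      (rule transport_push_name[OF shift_rel_push(2) gather_no_derivation_weaken(2)])
next
  case (Named a t)
  show ?case unfolding shift_var_cmd.simps
    by (rule derives_Named_transport[OF additive_shift_rel(1) shift_rel_label(1) Named])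
qed

lemma derives_shift_name_transport:
  "derives (shift_name k t) U E \<longleftrightarrow>
     transport (shift_rel (weaken_name k)) no_derivation (derives t U) E"
  "derives_cmd (shift_name_cmd k c) E \<longleftrightarrow>
     transport (shift_rel (weaken_name k)) no_derivation (derives_cmd c) E"
proof (induction t and c arbitrary: k U E and k E)
  case (Var x)
  show ?case
    by (auto simp: transport_shift_rel weaken_name_def insert_zero_single)
next
  case (Lam t)
  show ?case unfolding shift_name.simps
    by (rule derives_Lam_transport, unfold Lam)
      (rule transport_push_var[OF shift_rel_push(4) gather_no_derivation_weaken(1)])
next
  case (App t u)
  show ?case unfolding shift_name.simps
    by (rule derives_App_transport[OF additive_shift_rel(2) shift_rel_cost(2) App])
next
  case (Mu c)
  show ?case unfolding shift_name.simps
    by (rule derives_Mu_transport, unfold Mu)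
      (rule transport_push_name[OF shift_rel_push(3) gather_no_derivation_weaken(2)])
next
  case (Named a t)
  show ?case unfolding shift_name_cmd.simps
    by (rule derives_Named_transport[OF additive_shift_rel(2) shift_rel_label(2) Named])
qed

text \<open>This discharges the hypothesis \<open>Q\<close> of \<open>transport_push_var\<close>
  whenever substitution or replacement shifts its argument to pass a \<open>Lam\<close>.\<close>

lemma gather_derives_shift_var:
  "gather (derives (shift_var 0 u)) J E \<longleftrightarrow> (\<exists>E'. E = weaken_var 0 E' \<and> gather (derives u) J E')"
proof -
  have "derives (shift_var 0 u) =
    (\<lambda>U. transport (shift_rel (weaken_var 0)) no_derivation (derives u U))"
    by (intro ext) (rule derives_shift_var_transport(1))
  then have "gather (derives (shift_var 0 u)) J =
    transport (shift_rel (weaken_var 0)) no_derivation (gather (derives u) J)"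
    by (simp only: transport_gather[OF additive_shift_rel(1)])
  then show ?thesis by (auto simp: transport_shift_rel)
qed

lemma gather_derives_shift_name:
  "gather (derives (shift_name 0 u)) J E \<longleftrightarrow> (\<exists>E'. E = weaken_name 0 E' \<and> gather (derives u) J E')"
proof -
  have "derives (shift_name 0 u) =
    (\<lambda>U. transport (shift_rel (weaken_name 0)) no_derivation (derives u U))"
    by (intro ext) (rule derives_shift_name_transport(1))
  then have "gather (derives (shift_name 0 u)) J =
    transport (shift_rel (weaken_name 0)) no_derivation (gather (derives u) J)"
    by (simp only: transport_gather[OF additive_shift_rel(2)])
  then show ?thesis by (auto simp: transport_shift_rel)
qed


subsection \<open>Substitution\<close>

definition remove_var :: "nat \<Rightarrow> env \<Rightarrow> env" where
  "remove_var k E = (delete_at k (fst E), snd E)"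

text \<open>The entry of \<open>k\<close> lists one union type per typed occurrence of the variable,
  hence it is exactly the collection of types at which the argument is needed.\<close>

definition subst_rel :: "nat \<Rightarrow> env \<Rightarrow> env \<Rightarrow> inter_ty \<Rightarrow> bool" where
  "subst_rel k E E' J \<longleftrightarrow> E' = remove_var k E \<and> J = fst E k"

lemma remove_var_plus: "remove_var k (E + F) = remove_var k E + remove_var k F"
  by (simp add: remove_var_def delete_at_plus plus_prod_def)

lemma remove_var_zero: "remove_var k 0 = 0"
  by (simp add: remove_var_def zero_prod_def)

lemma additive_subst_rel: "additive (subst_rel k)"
  by (simp add: additive_def subst_rel_def remove_var_plus remove_var_zero)

lemma subst_rel_cost: "subst_rel k (cost s) E J \<longleftrightarrow> E = cost s \<and> J = {#}"
  by (simp add: subst_rel_def remove_var_def cost_def)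

lemma subst_rel_label: "subst_rel k (label a U s) E J \<longleftrightarrow> E = label a U s \<and> J = {#}"
  by (simp add: subst_rel_def remove_var_def label_def)

lemma subst_rel_push:
  "subst_rel (Suc k) (push_var I E1) E J \<longleftrightarrow> (\<exists>E'. E = push_var I E' \<and> subst_rel k E1 E' J)"
  "subst_rel k (push_name U E1) E J \<longleftrightarrow> (\<exists>E'. E = push_name U E' \<and> subst_rel k E1 E' J)"
  by (auto simp: subst_rel_def remove_var_def push_var_def push_name_def delete_at_case_nat)

lemma subst_rel_0_push: "subst_rel 0 (push_var I E) E' J \<longleftrightarrow> E' = E \<and> J = I"
  by (cases E) (auto simp: subst_rel_def remove_var_def push_var_def delete_at_def)

section \<open>Properness of derivable types and environments\<close>

definition proper_union :: "union_ty \<Rightarrow> bool" where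
  "proper_union U \<longleftrightarrow> (\<forall>\<sigma> \<in># U. proper \<sigma>)"

lemma proper_union_simps [simp]:
  "proper_union {#}" "proper_union (add_mset \<sigma> U) \<longleftrightarrow> proper \<sigma> \<and> proper_union U"
  "proper_union (U + V) \<longleftrightarrow> proper_union U \<and> proper_union V"
  by (auto simp: proper_union_def)

definition proper_env :: "env \<Rightarrow> bool" where
  "proper_env E \<longleftrightarrow> (\<forall>x. \<forall>U \<in># fst E x. proper_union U) \<and> (\<forall>a. proper_union (fst (snd E) a))"

lemma proper_env_plus: "proper_env (E + F) \<longleftrightarrow> proper_env E \<and> proper_env F"
  by (auto simp: proper_env_def)

lemma proper_env_zero: "proper_env 0"
  by (simp add: proper_env_def)

lemma proper_env_cost: "proper_env (cost s)"
  by (simp add: proper_env_def cost_def)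

lemma proper_env_label: "proper_env (label a U s) \<longleftrightarrow> proper_union U"
  by (auto simp: proper_env_def label_def single_def)

lemma proper_env_push_var:
  "proper_env (push_var I E) \<longleftrightarrow> (\<forall>U \<in># I. proper_union U) \<and> proper_env E"
  by (auto simp: proper_env_def push_var_def split: nat.splits)

lemma proper_env_push_name:
  "proper_env (push_name U E) \<longleftrightarrow> proper_union U \<and> proper_env E"
  by (auto simp: proper_env_def push_name_def split: nat.splits)

lemma blind_imp_proper: "blind \<xi> \<Longrightarrow> proper \<xi>"
  by (induction rule: blind.induct) (auto intro: proper.intros)

lemma proper_Arrow_iff:
  "proper (Arrow I V) \<longleftrightarrow> (\<forall>U \<in># I. proper_union U) \<and> V \<noteq> {#} \<and> proper_union V"
  by (auto simp: proper_union_def intro: proper.intros elim: proper.cases)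

text \<open>Each proper arrow has a non-empty target. Otherwise a replacement could empty the type
  of a used name, and the choice operator would turn blind for the contractum but not for the
  redex.\<close>

lemma targets_eq_empty:
  assumes "proper_union (arrows M)" "targets M = {#}"
  shows "M = {#}"
  using assms by (cases M) (auto simp: proper_Arrow_iff)

lemma proper_union_targets: "proper_union (arrows M) \<Longrightarrow> proper_union (targets M)"
  by (induction M) (auto simp: proper_Arrow_iff)

lemma gather_proper_env:
  assumes "gather P I E" "\<And>U E. P U E \<Longrightarrow> proper_env E"
  shows "proper_env E"
  using assms by (induction rule: gather.induct) (auto simp: proper_env_plus proper_env_zero)

lemma choice_proper:
  assumes "choice U V" "proper_union U"
  shows "V \<noteq> {#}" "proper_union V"
  using assms by (auto simp: proper_union_def blind_imp_proper elim: choice.cases)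

text \<open>Properness is demanded at variables only and propagates: choice adds blind types, which
  are proper, a \<open>Lam\<close> has a non-empty target by induction, and an application a
  non-empty type by \<open>targets_eq_empty\<close>.\<close>

lemma derives_proper:
  "derives t U E \<Longrightarrow> U \<noteq> {#} \<and> proper_union U \<and> proper_env E"
  "derives_cmd c E \<Longrightarrow> proper_env E"
proof (induction t and c arbitrary: U E and E)
  case (Var x)
  then show ?case by (auto simp: proper_env_def proper_union_def single_def)
next
  case (Lam t)
  then obtain I V where *: "U = {#Arrow I V#}" "derives t V (push_var I E)" by auto
  then show ?case using Lam.IH[OF *(2)]
    by (simp add: proper_env_push_var proper_Arrow_iff)
next
  case (App t u)
  then obtain M A B where *: "U = targets M" "derives t (arrows M) A"
    "gather (derives u) (sources M) B" "E = A + B + cost (size M)"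
    by (auto simp: combine_def)
  have "proper_env B" using gather_proper_env[OF *(3)] App.IH(2) by blast
  then show ?case using App.IH(1)[OF *(2)] * targets_eq_empty[of M] proper_union_targets[of M]
    by (auto simp: proper_env_plus proper_env_cost arrows_def)
next
  case (Mu c)
  then obtain V where *: "choice V U" "derives_cmd c (push_name V E)" by auto
  then show ?case using Mu.IH[OF *(2)] choice_proper by (auto simp: proper_env_push_name)
next
  case (Named a t)
  then show ?case by (auto simp: combine_def proper_env_plus proper_env_label)
qed

lemma derives_subst_transport:
  "derives (subst t k u) U E \<longleftrightarrow> transport (subst_rel k) (derives u) (derives t U) E"
  "derives_cmd (subst_cmd c k u) E \<longleftrightarrow> transport (subst_rel k) (derives u) (derives_cmd c) E"
proof (induction t and c arbitrary: k u U E and k u E)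
  case (Var x)
  have *: "transport (subst_rel k) (derives u) (derives (Var x) U) E \<longleftrightarrow>
    U \<noteq> {#} \<and> (\<forall>\<sigma> \<in># U. proper \<sigma>) \<and>
    (\<exists>E2. gather (derives u) (single x {#U#} k) E2 \<and> E = (delete_at k (single x {#U#}), 0, 0) + E2)"
    by (auto simp: transport_def subst_rel_def remove_var_def)
  \<comment> \<open>If \<open>x = k\<close>, nothing is left of the environment of the axiom, which
    is free of charge, so precisely one derivation of \<open>u\<close> remains.\<close>
  have "delete_at k (single x v) = (if x = k then 0 else single (if x < k then x else x - 1) v)"
    for v :: inter_ty by (auto simp: delete_at_def single_def fun_eq_iff)
  moreover have "single x v k = (if x = k then v else 0)" for v :: inter_ty
    by (auto simp: single_def)
  \<comment> \<open>Needed for \<open>x = k\<close>: a type derived for \<open>u\<close> has to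
    satisfy the side conditions of the axiom it stands for.\<close>
  moreover have "derives u U E \<Longrightarrow> U \<noteq> {#} \<and> (\<forall>\<sigma> \<in># U. proper \<sigma>)"
    using derives_proper(1) by (auto simp: proper_union_def)
  ultimately show ?case unfolding * by (auto simp flip: zero_prod_def)
next
  case (Lam t)
  show ?case unfolding subst.simps
    by (rule derives_Lam_transport, unfold Lam)
      (rule transport_push_var[OF subst_rel_push(1) gather_derives_shift_var])
next
  case (App t v)
  show ?case unfolding subst.simps
    by (rule derives_App_transport[OF additive_subst_rel subst_rel_cost App])
next
  case (Mu c)
  show ?case unfolding subst.simps
    by (rule derives_Mu_transport, unfold Mu)
      (rule transport_push_name[OF subst_rel_push(2) gather_derives_shift_name])
next
  case (Named a t)
  show ?case unfolding subst_cmd.simps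
    by (rule derives_Named_transport[OF additive_subst_rel subst_rel_label Named])
qed

subsection \<open>Replacement\<close>


text \<open>The relation is partial: all types recorded for \<open>k\<close> must be arrows, since
  every subterm named \<open>k\<close> is about to be applied. The cost is kept, although the types
  of the name lose their arrows.\<close>

definition replace_rel :: "nat \<Rightarrow> env \<Rightarrow> env \<Rightarrow> inter_ty \<Rightarrow> bool" where
  "replace_rel k E E' J \<longleftrightarrow> (\<exists>M. fst (snd E) k = arrows M \<and>
     E' = (fst E, (fst (snd E))(k := targets M), snd (snd E)) \<and> J = sources M)"

lemma arrows_eq_empty [simp]: "arrows M = {#} \<longleftrightarrow> M = {#}" "{#} = arrows M \<longleftrightarrow> M = {#}"
  by (auto simp: arrows_def)

lemma arrows_eq_plus: "U + V = arrows M \<longleftrightarrow> (\<exists>N N'. U = arrows N \<and> V = arrows N' \<and> M = N + N')"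
  by (auto simp: arrows_def dest!: image_mset_eq_plusD[OF sym])

lemma arrows_eq_single: "arrows M = {#Arrow I V#} \<longleftrightarrow> M = {#(I, V)#}"
  by (cases M) (auto simp: prod_eq_iff)

lemma arity_arrows: "arity (arrows M) = arity (targets M) + size M"
  by (induction M) (simp_all add: arity_def)

lemma fun_upd_plus: "(f + g)(k := u + v) = f(k := u) + g(k := v)"
  for f g :: "nat \<Rightarrow> 'a::plus"
  by (simp add: fun_eq_iff)

text \<open>The arrow types at \<open>k\<close> are distributed over the two summands, and as
  \<open>arrows\<close> is an image multiset, the pairs in \<open>M\<close> can be distributed
  accordingly (\<open>arrows_eq_plus\<close>).\<close>

lemma additive_replace_rel: "additive (replace_rel k)"
proof -
  have "replace_rel k 0 E J \<longleftrightarrow> E = 0 \<and> J = {#}" for E J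
    by (auto simp: replace_rel_def zero_prod_def fun_eq_iff)
  moreover have "replace_rel k (A + B) E J \<longleftrightarrow>
      (\<exists>A' B' I1 I2. replace_rel k A A' I1 \<and> replace_rel k B B' I2 \<and> E = A' + B' \<and> J = I1 + I2)"
    for A B E J
  proof
    assume "replace_rel k (A + B) E J"
    then obtain N N' where "fst (snd A) k = arrows N" "fst (snd B) k = arrows N'"
      "E = (fst A + fst B, (fst (snd A) + fst (snd B))(k := targets N + targets N'),
        snd (snd A) + snd (snd B))" "J = sources N + sources N'"
      by (auto simp: replace_rel_def arrows_eq_plus)
    then show "\<exists>A' B' I1 I2. replace_rel k A A' I1 \<and> replace_rel k B B' I2 \<and> E = A' + B' \<and> J = I1 + I2"
      unfolding replace_rel_def fun_upd_plus
      by (intro exI[of _ "(fst A, (fst (snd A))(k := targets N), snd (snd A))"]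
          exI[of _ "(fst B, (fst (snd B))(k := targets N'), snd (snd B))"]
          exI[of _ "sources N"] exI[of _ "sources N'"]) auto
  next
    assume "\<exists>A' B' I1 I2. replace_rel k A A' I1 \<and> replace_rel k B B' I2 \<and> E = A' + B' \<and> J = I1 + I2"
    then obtain N N' where "fst (snd A) k = arrows N" "fst (snd B) k = arrows N'"
      "E = (fst A, (fst (snd A))(k := targets N), snd (snd A)) +
        (fst B, (fst (snd B))(k := targets N'), snd (snd B))" "J = sources N + sources N'"
      by (auto simp: replace_rel_def)
    then show "replace_rel k (A + B) E J"
      unfolding replace_rel_def by (intro exI[of _ "N + N'"]) (simp flip: fun_upd_plus)
  qed
  ultimately show ?thesis by (simp add: additive_def)
qed

lemma replace_rel_cost: "replace_rel k (cost s) E J \<longleftrightarrow> E = cost s \<and> J = {#}"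
  by (auto simp: replace_rel_def cost_def fun_eq_iff)

lemma replace_rel_label:
  "a \<noteq> k \<Longrightarrow> replace_rel k (label a U s) E J \<longleftrightarrow> E = label a U s \<and> J = {#}"
  by (auto simp: replace_rel_def label_def single_def fun_eq_iff)

lemma replace_rel_label_same:
  "replace_rel k (label k U s) E J \<longleftrightarrow>
     (\<exists>M. U = arrows M \<and> E = label k (targets M) s \<and> J = sources M)"
proof -
  have "(single k U)(k := V) = single k V" for V by (auto simp: single_def)
  then show ?thesis by (simp add: replace_rel_def label_def single_def[of k U for U])
qed

lemma replace_rel_push:
  "replace_rel k (push_var I E1) E J \<longleftrightarrow> (\<exists>E'. E = push_var I E' \<and> replace_rel k E1 E' J)"
  "replace_rel (Suc k) (push_name U E1) E J \<longleftrightarrow> (\<exists>E'. E = push_name U E' \<and> replace_rel k E1 E' J)"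
proof -
  show "replace_rel k (push_var I E1) E J \<longleftrightarrow> (\<exists>E'. E = push_var I E' \<and> replace_rel k E1 E' J)"
    by (auto simp: replace_rel_def push_var_def split_paired_Ex)
  have "(case_nat U f)(Suc k := V) = case_nat U (f(k := V))" for f V
    by (auto simp: fun_eq_iff split: nat.split)
  then show "replace_rel (Suc k) (push_name U E1) E J \<longleftrightarrow>
      (\<exists>E'. E = push_name U E' \<and> replace_rel k E1 E' J)"
    by (auto simp: replace_rel_def push_name_def split_paired_Ex)
qed

lemma replace_rel_0_push:
  "replace_rel 0 (push_name U E) E' J \<longleftrightarrow>
     (\<exists>M. U = arrows M \<and> E' = push_name (targets M) E \<and> J = sources M)"
proof -
  have "(case_nat U f)(0 := V) = case_nat V f" for f V
    by (auto simp: fun_eq_iff split: nat.split)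
  then show ?thesis by (auto simp: replace_rel_def push_name_def)
qed

text \<open>
  The applications created by a replacement are paid for by the arity of the type of the named
  subterm, which drops by one for each arrow that is consumed.
\<close>

lemma derives_Named_App_transport:
  assumes "\<And>U E. derives t' U E \<longleftrightarrow> transport (replace_rel k) (derives u) (derives t U) E"
  shows "derives_cmd (Named k (App t' u)) E \<longleftrightarrow>
    transport (replace_rel k) (derives u) (derives_cmd (Named k t)) E"
proof -
  have t: "derives t' = (\<lambda>U. transport (replace_rel k) (derives u) (derives t U))"
    using assms by (simp add: fun_eq_iff)
  have split: "label k (targets M) (arity (arrows M)) =
    cost (size M) + label k (targets M) (arity (targets M))" for M
    by (simp add: arity_arrows label_def cost_def)
  have point: "transport (replace_rel k) (derives u) (\<lambda>B. B = label k U s) B \<longleftrightarrow>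
    (\<exists>M G. U = arrows M \<and> gather (derives u) (sources M) G \<and> B = label k (targets M) s + G)"
    for U s B
    by (auto simp: transport_def replace_rel_label_same)
  show ?thesis
  proof
    assume "derives_cmd (Named k (App t' u)) E"
    then obtain M F G where *: "derives t' (arrows M) F" "gather (derives u) (sources M) G"
      "E = (F + G + cost (size M)) + label k (targets M) (arity (targets M))"
      by (auto simp: combine_def)
    have "E = F + (label k (targets M) (arity (arrows M)) + G)"
      by (simp only: *(3) split add.assoc add.commute add.left_commute)
    moreover have "transport (replace_rel k) (derives u)
        (\<lambda>B. B = label k (arrows M) (arity (arrows M))) (label k (targets M) (arity (arrows M)) + G)"
      unfolding point using * by blast
    ultimately show "transport (replace_rel k) (derives u) (derives_cmd (Named k t)) E"
      unfolding derives_cmd.simps transport_Ex transport_combine[OF additive_replace_rel]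
      using * t by (auto intro!: exI[of _ "arrows M"] combineI)
  next
    assume "transport (replace_rel k) (derives u) (derives_cmd (Named k t)) E"
    then obtain M F G where "derives t' (arrows M) F" "gather (derives u) (sources M) G"
      and E: "E = F + (label k (targets M) (arity (arrows M)) + G)"
      unfolding derives_cmd.simps transport_Ex transport_combine[OF additive_replace_rel]
      unfolding combine_def point by (auto simp: t)
    moreover have "E = (F + G + cost (size M)) + label k (targets M) (arity (targets M))"
      by (simp only: E split add.assoc add.commute add.left_commute)
    ultimately show "derives_cmd (Named k (App t' u)) E"
      unfolding derives_cmd.simps derives.simps combine_def by blast
  qed
qed

lemma derives_replace_transport:
  "derives (replace t k u) U E \<longleftrightarrow> transport (replace_rel k) (derives u) (derives t U) E"
  "derives_cmd (replace_cmd c k u) E \<longleftrightarrow> transport (replace_rel k) (derives u) (derives_cmd c) E"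
proof (induction t and c arbitrary: k u U E and k u E)
  case (Var x)
  have "replace_rel k (single x {#U#}, 0, 0) E' J \<longleftrightarrow> E' = (single x {#U#}, 0, 0) \<and> J = {#}" for E' J
    by (auto simp: replace_rel_def fun_eq_iff)
  then show ?case by (auto simp: transport_conj transport_point)
next
  case (Lam t)
  show ?case unfolding replace.simps
    by (rule derives_Lam_transport, unfold Lam)
      (rule transport_push_var[OF replace_rel_push(1) gather_derives_shift_var])
next
  case (App t v)
  show ?case unfolding replace.simps
    by (rule derives_App_transport[OF additive_replace_rel replace_rel_cost App])
next
  case (Mu c)
  show ?case unfolding replace.simps
    by (rule derives_Mu_transport, unfold Mu)
      (rule transport_push_name[OF replace_rel_push(2) gather_derives_shift_name])
next
  case (Named a t)
  show ?case
  proof (cases "a = k")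
    case True
    then show ?thesis using derives_Named_App_transport[OF Named] by simp
  next
    case False
    then show ?thesis
      using derives_Named_transport[OF additive_replace_rel replace_rel_label Named, of a k] by simp
  qed
qed

section \<open>Subject reduction and expansion\<close>

text \<open>An abstraction has a single arrow type, so \<open>M\<close> is one pair and the
  application costs exactly 1. The rest is the equivalence for substitution, which neither gains nor
  loses cost.\<close>

lemma derives_beta:
  "derives (App (Lam t) u) V E \<longleftrightarrow> (\<exists>E'. derives (subst t 0 u) V E' \<and> E = E' + cost 1)"
proof -
  have "derives (App (Lam t) u) V E \<longleftrightarrow>
    (\<exists>I A B. derives t V (push_var I A) \<and> gather (derives u) I B \<and> E = A + B + cost 1)"
  proof
    assume "derives (App (Lam t) u) V E"
    then obtain M I A B where "V = targets M" "M = {#(I, V)#}" "derives t V (push_var I A)"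
      "gather (derives u) (sources M) B" "E = A + B + cost (size M)"
      unfolding derives.simps combine_def arrows_eq_single by fastforce
    then show "\<exists>I A B. derives t V (push_var I A) \<and> gather (derives u) I B \<and> E = A + B + cost 1"
      by auto
  next
    assume "\<exists>I A B. derives t V (push_var I A) \<and> gather (derives u) I B \<and> E = A + B + cost 1"
    then obtain I A B where "derives t V (push_var I A)" "gather (derives u) I B" "E = A + B + cost 1"
      by blast
    then have "combine (combine (derives (Lam t) (arrows {#(I, V)#}))
        (gather (derives u) (sources {#(I, V)#}))) (\<lambda>C. C = cost (size {#(I, V)#})) E"
      by (auto intro!: combineI)
    then show "derives (App (Lam t) u) V E"
      unfolding derives.simps(3) by (intro exI[of _ "{#(I, V)#}"]) simp
  qed
  also have "\<dots> \<longleftrightarrow> (\<exists>E'. derives (subst t 0 u) V E' \<and> E = E' + cost 1)"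
    unfolding derives_subst_transport transport_def
      ex_push_var[of "\<lambda>E. \<exists>E' J E2. derives t V E \<and> _ E E' J E2"] subst_rel_0_push by blast
  finally show ?thesis .
qed

text \<open>The name 0 survives the replacement, hence its entry is kept and changes from
  \<open>arrows M\<close> to \<open>targets M\<close>. The shifted argument adds nothing to
  it.\<close>

lemma derives_replace_0:
  "derives_cmd (replace_cmd c 0 (shift_name 0 u)) (push_name U E) \<longleftrightarrow>
    (\<exists>M A B. U = targets M \<and> derives_cmd c (push_name (arrows M) A) \<and>
       gather (derives u) (sources M) B \<and> E = A + B)"
  unfolding derives_replace_transport transport_def gather_derives_shift_name
    ex_push_name[of "\<lambda>E. \<exists>E' J E2. derives_cmd c E \<and> _ E E' J E2"] replace_rel_0_push
  by (metis push_name_eq_plus_weaken[of U E])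

lemma derives_App_Mu:
  "derives (App (Mu c) u) V E \<longleftrightarrow> (\<exists>M U A B. V = targets M \<and> choice U (arrows M) \<and>
     derives_cmd c (push_name U A) \<and> gather (derives u) (sources M) B \<and> E = A + B + cost (size M))"
  unfolding derives.simps combine_def by blast

text \<open>The outer application disappears and saves \<open>size M\<close>, which is positive
  because choice never yields an empty type. The cases are whether the name carries types or its
  type is a blind choice.\<close>

lemma derives_mu_reduction:
  assumes "derives (App (Mu c) u) V E"
  obtains E' s where "s > 0" "derives (Mu (replace_cmd c 0 (shift_name 0 u))) V E'" "E = E' + cost s"
proof -
  from assms obtain M U A B where *: "V = targets M" "choice U (arrows M)"
    "derives_cmd c (push_name U A)" "gather (derives u) (sources M) B" "E = A + B + cost (size M)"
    unfolding derives_App_Mu by blast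
  have "proper_union U" using derives_proper(2)[OF *(3)] by (simp add: proper_env_push_name)
  from *(2) show thesis
  proof cases
    case choice_nonempty
    with \<open>proper_union U\<close> have "M \<noteq> {#}" "targets M \<noteq> {#}"
      using targets_eq_empty by auto
    moreover have "derives_cmd (replace_cmd c 0 (shift_name 0 u)) (push_name (targets M) (A + B))"
      unfolding derives_replace_0 using * choice_nonempty by blast
    moreover have "choice (targets M) (targets M)"
      using calculation by (intro choice.choice_nonempty)
    ultimately show thesis
      using that[of "size M" "A + B"] * by (auto simp: nonempty_has_size)
  next
    case (choice_empty \<xi>)
    \<comment> \<open>The target of a blind arrow type is blind and thus a legal choice for the contractum.\<close>
    from choice_empty have "\<xi> = Arrow I W \<Longrightarrow> \<exists>\<xi>'. blind \<xi>' \<and> I = {#} \<and> W = {#\<xi>'#}" for I W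
      by (auto elim: blind.cases)
    moreover from choice_empty obtain p where "\<xi> = Arrow (fst p) (snd p)"
      by (cases M) auto
    ultimately obtain \<xi>' where \<xi>': "blind \<xi>'" "\<xi> = Arrow {#} {#\<xi>'#}" by blast
    then have M: "M = {#({#}, {#\<xi>'#})#}" using choice_empty by (simp add: arrows_eq_single)
    then have "B = 0" "V = {#\<xi>'#}" using * by simp_all
    moreover have "derives_cmd (replace_cmd c 0 (shift_name 0 u)) (push_name {#} A)"
      unfolding derives_replace_0 using *(3) choice_empty
      \<comment> \<open>The body gives the name no type, so the replacement consumes no derivation
        of \<open>u\<close> and its multiset of pairs is empty, although that of the outer
        application is not.\<close>
      by (intro exI[of _ "{#}"] exI[of _ A] exI[of _ 0]) simp
    moreover have "choice {#} {#\<xi>'#}" using \<xi>' by (intro choice.choice_empty)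
    ultimately show thesis using that[of 1 A] *(5) M by auto
  qed
qed

lemma derives_mu_expansion:
  assumes "derives (Mu (replace_cmd c 0 (shift_name 0 u))) V E"
  obtains s where "derives (App (Mu c) u) V (E + cost s)"
proof -
  from assms obtain M A B where *: "choice (targets M) V"
    "derives_cmd c (push_name (arrows M) A)" "gather (derives u) (sources M) B" "E = A + B"
    unfolding derives.simps derives_replace_0 by blast
  have proper: "proper_union (arrows M)"
    using derives_proper(2)[OF *(2)] by (simp add: proper_env_push_name)
  from *(1) show thesis
  proof cases
    case choice_nonempty
    then have "choice (arrows M) (arrows M)" by (intro choice.choice_nonempty) auto
    then show thesis using that[of "size M"] * choice_nonempty unfolding derives_App_Mu by blast
  next
    case (choice_empty \<xi>)
    then have M: "M = {#}" using targets_eq_empty[OF proper] by simp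
    \<comment> \<open>The name is unused, so the blind type of the contractum has to be raised by one arrow.\<close>
    let ?N = "{#({#} :: inter_ty, {#\<xi>#})#}"
    have "choice {#} (arrows ?N)"
      using choice_empty by (auto intro: choice.choice_empty blind.blind_Arrow)
    moreover have "B = 0" using *(3) M by simp
    ultimately have "derives (App (Mu c) u) V (E + cost (size ?N))"
      unfolding derives_App_Mu using * M choice_empty
      by (intro exI[of _ ?N] exI[of _ "{#}"] exI[of _ A] exI[of _ 0]) simp
    then show thesis by (rule that)
  qed
qed

section \<open>Cost of reduction and expansion inside contexts\<close>

definition cheaper :: "(env \<Rightarrow> bool) \<Rightarrow> (env \<Rightarrow> bool) \<Rightarrow> bool" where
  "cheaper P Q \<longleftrightarrow> (\<forall>E. Q E \<longrightarrow> (\<exists>E' s. s > 0 \<and> P E' \<and> E = E' + cost s))"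

text \<open>The increase \<open>s\<close> may be 0, as happens for a step inside an argument that is
  typed no times. Only the assignments have to be preserved.\<close>

definition expandable :: "(env \<Rightarrow> bool) \<Rightarrow> (env \<Rightarrow> bool) \<Rightarrow> bool" where
  "expandable P Q \<longleftrightarrow> (\<forall>E. P E \<longrightarrow> (\<exists>s. Q (E + cost s)))"

lemma contract_cheaper: "contract r r' \<Longrightarrow> cheaper (derives r' V) (derives r V)"
  unfolding cheaper_def
proof (induction rule: contract.induct)
  case (contract_beta t u)
  then show ?case unfolding derives_beta using zero_less_one by blast
next
  case (contract_mu c u)
  then show ?case using derives_mu_reduction by metis
qed

lemma contract_expandable: "contract r r' \<Longrightarrow> expandable (derives r' V) (derives r V)"
  unfolding expandable_def
proof (induction rule: contract.induct)
  case (contract_beta t u)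
  then show ?case unfolding derives_beta by metis
next
  case (contract_mu c u)
  then show ?case using derives_mu_expansion by metis
qed

lemma push_var_plus_cost: "push_var I (E + cost s) = push_var I E + cost s"
  by (cases E) (simp add: push_var_def cost_def)

lemma push_name_plus_cost: "push_name U (E + cost s) = push_name U E + cost s"
  by (cases E) (simp add: push_name_def cost_def)

lemma cost_plus: "cost (m + n) = cost m + cost n"
  by (simp add: cost_def)

lemma push_var_eq_plus_cost:
  assumes "push_var I E = F + cost s"
  obtains E' where "F = push_var I E'" "E = E' + cost s"
  \<comment> \<open>\<open>cost s\<close> affects only the last component, so \<open>E\<close>
    supplies the assignments and \<open>F\<close> the reduced cost.\<close>
  using assms that[of "(fst E, fst (snd E), snd (snd F))"]
  by (cases E; cases F) (auto simp: push_var_def cost_def)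

lemma push_name_eq_plus_cost:
  assumes "push_name U E = F + cost s"
  obtains E' where "F = push_name U E'" "E = E' + cost s"
  using assms that[of "(fst E, fst (snd E), snd (snd F))"]
  by (cases E; cases F) (auto simp: push_name_def cost_def)

text \<open>Strictness is carried through the left summand, which is where the function of an
  application and the subterm of a command stand. A head redex is reached through such positions and
  binders only.\<close>

lemma cheaper_combine:
  assumes "cheaper P' P"
  shows "cheaper (combine P' Q) (combine P Q)"
  unfolding cheaper_def
proof (intro allI impI)
  fix E assume "combine P Q E"
  then obtain A B where *: "P A" "Q B" "E = A + B" unfolding combine_def by blast
  with assms obtain A' s where "s > 0" "P' A'" "A = A' + cost s" unfolding cheaper_def by blast
  with * show "\<exists>E' s. s > 0 \<and> combine P' Q E' \<and> E = E' + cost s"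
    by (intro exI[of _ "A' + B"] exI[of _ s]) (auto intro: combineI simp: ac_simps)
qed

lemma cheaper_Ex:
  assumes "\<And>x. cheaper (P' x) (P x)"
  shows "cheaper (\<lambda>E. \<exists>x. P' x E) (\<lambda>E. \<exists>x. P x E)"
  using assms unfolding cheaper_def by meson

lemma cheaper_conj: "cheaper P' P \<Longrightarrow> cheaper (\<lambda>E. a \<and> P' E) (\<lambda>E. a \<and> P E)"
  unfolding cheaper_def by meson

lemma cheaper_push_var:
  assumes "cheaper P' P"
  shows "cheaper (\<lambda>E. P' (push_var I E)) (\<lambda>E. P (push_var I E))"
  unfolding cheaper_def
proof (intro allI impI)
  fix E assume "P (push_var I E)"
  with assms obtain F s where *: "s > 0" "P' F" "push_var I E = F + cost s"
    unfolding cheaper_def by blast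
  from *(3) obtain E' where "F = push_var I E'" "E = E' + cost s" by (rule push_var_eq_plus_cost)
  with * show "\<exists>E' s. s > 0 \<and> P' (push_var I E') \<and> E = E' + cost s" by blast
qed

lemma cheaper_push_name:
  assumes "cheaper P' P"
  shows "cheaper (\<lambda>E. P' (push_name U E)) (\<lambda>E. P (push_name U E))"
  unfolding cheaper_def
proof (intro allI impI)
  fix E assume "P (push_name U E)"
  with assms obtain F s where *: "s > 0" "P' F" "push_name U E = F + cost s"
    unfolding cheaper_def by blast
  from *(3) obtain E' where "F = push_name U E'" "E = E' + cost s" by (rule push_name_eq_plus_cost)
  with * show "\<exists>E' s. s > 0 \<and> P' (push_name U E') \<and> E = E' + cost s" by blast
qed

lemma cheaper_Lam:
  "(\<And>V. cheaper (derives t' V) (derives t V)) \<Longrightarrow>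
    cheaper (derives (Lam t') V) (derives (Lam t) V)"
  unfolding derives.simps by (intro cheaper_Ex cheaper_conj cheaper_push_var)

lemma cheaper_App:
  "(\<And>V. cheaper (derives t' V) (derives t V)) \<Longrightarrow>
    cheaper (derives (App t' u) V) (derives (App t u) V)"
  unfolding derives.simps by (intro cheaper_Ex cheaper_conj cheaper_combine)

lemma cheaper_Mu:
  "cheaper (derives_cmd c') (derives_cmd c) \<Longrightarrow>
    cheaper (derives (Mu c') V) (derives (Mu c) V)"
  unfolding derives.simps by (intro cheaper_Ex cheaper_conj cheaper_push_name)

lemma cheaper_Named:
  "(\<And>V. cheaper (derives t' V) (derives t V)) \<Longrightarrow>
    cheaper (derives_cmd (Named a t')) (derives_cmd (Named a t))"
  unfolding derives_cmd.simps by (intro cheaper_Ex cheaper_combine)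

lemma cheaper_foldl_App:
  "(\<And>V. cheaper (derives r' V) (derives r V)) \<Longrightarrow>
    cheaper (derives (foldl App r' ts) V) (derives (foldl App r ts) V)"
  by (induction ts arbitrary: V rule: rev_induct) (auto intro: cheaper_App simp del: derives.simps)

lemma head_context_cheaper:
  assumes "\<And>V. cheaper (derives r' V) (derives r V)"
  shows "cheaper (derives (fill_ht H r') V) (derives (fill_ht H r) V)"
    and "cheaper (derives_cmd (fill_hc C r')) (derives_cmd (fill_hc C r))"
proof (induction H and C arbitrary: V)
  case (HHole ts)
  then show ?case using cheaper_foldl_App[OF assms] by simp
qed (simp_all only: fill_ht.simps fill_hc.simps cheaper_Lam cheaper_Mu cheaper_Named)

lemma expandable_combine_left:
  assumes "expandable P' P"
  shows "expandable (combine P' Q) (combine P Q)"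
  unfolding expandable_def
proof (intro allI impI)
  fix E assume "combine P' Q E"
  then obtain A B where *: "P' A" "Q B" "E = A + B" unfolding combine_def by blast
  with assms obtain s where "P (A + cost s)" unfolding expandable_def by blast
  then have "combine P Q (A + cost s + B)" using * by (intro combineI)
  then show "\<exists>s. combine P Q (E + cost s)" using * by (auto simp: ac_simps)
qed

lemma combine_commute: "combine P Q = combine Q P" for P Q :: "env \<Rightarrow> bool"
  unfolding combine_def fun_eq_iff by (metis add.commute)

lemma expandable_combine_right: "expandable Q' Q \<Longrightarrow> expandable (combine P Q') (combine P Q)"
  unfolding combine_commute[of P] by (rule expandable_combine_left)

lemma expandable_Ex:
  assumes "\<And>x. expandable (P' x) (P x)"
  shows "expandable (\<lambda>E. \<exists>x. P' x E) (\<lambda>E. \<exists>x. P x E)"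
  using assms unfolding expandable_def by meson

lemma expandable_conj: "expandable P' P \<Longrightarrow> expandable (\<lambda>E. a \<and> P' E) (\<lambda>E. a \<and> P E)"
  unfolding expandable_def by meson

lemma expandable_push:
  "expandable P' P \<Longrightarrow> expandable (\<lambda>E. P' (push_var I E)) (\<lambda>E. P (push_var I E))"
  "expandable P' P \<Longrightarrow> expandable (\<lambda>E. P' (push_name U E)) (\<lambda>E. P (push_name U E))"
  by (simp_all add: expandable_def push_var_plus_cost push_name_plus_cost)

text \<open>One step in an argument affects every derivation gathered for it, so the individual
  increases add up.\<close>

lemma expandable_gather:
  assumes "\<And>U. expandable (P' U) (P U)"
  shows "expandable (gather P' I) (gather P I)"
  unfolding expandable_def
proof (intro allI impI)
  fix E assume "gather P' I E"
  then show "\<exists>s. gather P I (E + cost s)"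
  proof induction
    case gather_empty
    have "cost 0 = 0" by (simp add: cost_def zero_prod_def)
    then have "gather P {#} (0 + cost 0)" by simp
    then show ?case ..
  next
    case (gather_add U E I F)
    then obtain m n where "P U (E + cost m)" "gather P I (F + cost n)"
      using assms unfolding expandable_def by blast
    then have "gather P (add_mset U I) ((E + cost m) + (F + cost n))" by (rule gather.gather_add)
    then have "gather P (add_mset U I) (E + F + cost (m + n))" by (simp add: cost_plus ac_simps)
    then show ?case ..
  qed
qed

lemma step_expandable:
  "step_trm t t' \<Longrightarrow> expandable (derives t' V) (derives t V)"
  "step_cmd c c' \<Longrightarrow> expandable (derives_cmd c') (derives_cmd c)"
proof (induction arbitrary: V rule: step_trm_step_cmd.inducts)
  case (step_contract r r')
  then show ?case by (rule contract_expandable)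
next
  case step_Lam
  then show ?case unfolding derives.simps by (intro expandable_Ex expandable_conj expandable_push)
next
  case step_App_left
  then show ?case unfolding derives.simps
    by (intro expandable_Ex expandable_conj expandable_combine_left)
next
  case step_App_right
  then show ?case unfolding derives.simps
    by (intro expandable_Ex expandable_conj expandable_combine_left expandable_combine_right
        expandable_gather)
next
  case step_Mu
  then show ?case unfolding derives.simps by (intro expandable_Ex expandable_conj expandable_push)
next
  case step_Named
  then show ?case unfolding derives_cmd.simps by (intro expandable_Ex expandable_combine_left)
qed

definition derives_obj :: "obj \<Rightarrow> obj_ty \<Rightarrow> env \<Rightarrow> bool" where
  "derives_obj ob A E \<longleftrightarrow> (case ob of
     Term t \<Rightarrow> (\<exists>U. A = UnionTy U \<and> derives t U E)
   | Command c \<Rightarrow> A = Hash \<and> derives_cmd c E)"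

lemma head_step_cheaper:
  assumes "head_step ob ob'"
  shows "cheaper (derives_obj ob' A) (derives_obj ob A)"
  using assms
proof cases
  case (1 r r' H)
  note * = head_context_cheaper[OF contract_cheaper[OF 1(3)]]
  show ?thesis
  proof (cases H)
    case (HTerm H')
    then show ?thesis unfolding 1
      by (simp add: derives_obj_def[abs_def] cheaper_Ex cheaper_conj *)
  next
    case (HCommand C)
    then show ?thesis unfolding 1 by (simp add: derives_obj_def[abs_def] cheaper_conj *)
  qed
qed

lemma step_derives_obj:
  assumes "step ob ob'" "derives_obj ob' A E"
  shows "\<exists>E. derives_obj ob A E"
  using assms
proof cases
  case (step_Term t t')
  then show ?thesis
    using assms(2) step_expandable(1) unfolding derives_obj_def expandable_def by fastforce
next
  case (step_Command c c')
  then show ?thesis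
    using assms(2) step_expandable(2) unfolding derives_obj_def expandable_def by fastforce
qed

lemma head_step_power_le:
  assumes "(head_step ^^ m) ob ob'" "derives_obj ob A E"
  shows "m \<le> snd (snd E)"
  using assms
proof (induction m arbitrary: ob E)
  case (Suc m)
  then obtain ob1 where "head_step ob ob1" "(head_step ^^ m) ob1 ob'"
    by (meson relpowp_Suc_E2)
  moreover from this Suc.prems obtain E' s where "s > 0" "derives_obj ob1 A E'" "E = E' + cost s"
    using head_step_cheaper unfolding cheaper_def by blast
  ultimately show ?case using Suc.IH by (fastforce simp: cost_def)
qed simp

section \<open>Head-normal forms and progress\<close>

lemma derives_foldl_App_Var:
  "\<exists>E. derives (foldl App (Var x) ts) {#Base b#} E"
proof -
  \<comment> \<open>Generalized to all blind types, because each further argument requires a head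
    type with one more arrow. The source of that arrow is empty, so arguments need no
    derivation.\<close>
  have "blind \<xi> \<Longrightarrow> \<exists>E. derives (foldl App (Var x) ts) {#\<xi>#} E" for \<xi>
  proof (induction ts arbitrary: \<xi> rule: rev_induct)
    case Nil
    then show ?case by (auto simp: blind_imp_proper)
  next
    case (snoc u ts)
    let ?M = "{#({#} :: inter_ty, {#\<xi>#})#}"
    from snoc obtain E where "derives (foldl App (Var x) ts) {#Arrow {#} {#\<xi>#}#} E"
      by (meson blind.blind_Arrow)
    then have "combine (combine (derives (foldl App (Var x) ts) (arrows ?M))
        (gather (derives u) (sources ?M))) (\<lambda>C. C = cost (size ?M)) (E + 0 + cost (size ?M))"
      by (intro combineI) simp_all
    then have "derives (App (foldl App (Var x) ts) u) {#\<xi>#} (E + 0 + cost (size ?M))"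
      unfolding derives.simps by (intro exI[of _ ?M]) simp
    then show ?case unfolding foldl_append foldl.simps ..
  qed
  then show ?thesis using blind.blind_Base by blast
qed

lemma head_context_derives:
  "\<exists>U E. derives (fill_ht H (Var x)) U E" "\<exists>E. derives_cmd (fill_hc C (Var x)) E"
proof (induction H and C)
  case (HHole ts)
  show ?case unfolding fill_ht.simps using derives_foldl_App_Var by blast
next
  case (HLam H)
  then obtain U E where "derives (fill_ht H (Var x)) U E" by blast
  then obtain I E where "derives (fill_ht H (Var x)) U (push_var I E)" using ex_push_var by metis
  then show ?case by auto
next
  case (HMu C)
  then obtain U E where "derives_cmd (fill_hc C (Var x)) (push_name U E)" using ex_push_name by metis
  \<comment> \<open>If the body leaves the name without types, a base type serves as the blind
    choice.\<close>
  moreover have "\<exists>V. choice U V"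
    by (cases "U = {#}") (auto intro: choice.intros blind.intros)
  ultimately show ?case by auto
next
  case (HNamed a H)
  then show ?case using combineI by fastforce
qed

lemma head_normal_derives_obj: "head_normal ob \<Longrightarrow> \<exists>A E. derives_obj ob A E"
  unfolding head_normal_def
proof (elim exE)
  fix H x assume "ob = fill H (Var x)"
  then show ?thesis
    using head_context_derives by (cases H) (simp_all add: derives_obj_def, blast)
qed

lemma head_context_progress:
  "(\<exists>H x. t = fill_ht H (Var x)) \<or> (\<exists>H r r'. contract r r' \<and> t = fill_ht H r)"
  "(\<exists>C x. c = fill_hc C (Var x)) \<or> (\<exists>C r r'. contract r r' \<and> c = fill_hc C r)"
proof (induction t and c)
  case (Var x)
  have "Var x = fill_ht (HHole []) (Var x)" by simp
  then show ?case by blast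
next
  case (Lam t)
  then show ?case by (metis fill_ht.simps(2))
next
  case (App t u)
  \<comment> \<open>A hole context absorbs \<open>u\<close> as its last argument. Otherwise the
    function part is a \<open>Lam\<close> or \<open>Mu\<close>, and the application itself is the
    head redex.\<close>
  have "(\<exists>ts. App (fill_ht H' r) u = fill_ht (HHole ts) r) \<or>
    (\<exists>q q'. contract q q' \<and> App (fill_ht H' r) u = fill_ht (HHole []) q)" for H' r
  proof (cases H')
    case (HHole ts)
    then have "App (fill_ht H' r) u = fill_ht (HHole (ts @ [u])) r" by simp
    then show ?thesis by blast
  qed (use contract.intros in \<open>fastforce+\<close>)
  then show ?case using App(1) by metis
next
  case (Mu c)
  then show ?case by (metis fill_ht.simps(3))
next
  case (Named a t)
  then show ?case by (metis fill_hc.simps)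
qed

lemma head_progress: "head_normal ob \<or> (\<exists>ob'. head_step ob ob')"
proof (cases ob)
  case (Term t)
  then show ?thesis using head_context_progress(1)[of t] head_step.intros
    unfolding head_normal_def by (metis fill.simps(1))
next
  case (Command c)
  then show ?thesis using head_context_progress(2)[of c] head_step.intros
    unfolding head_normal_def by (metis fill.simps(2))
qed

section \<open>Head steps as reduction steps, and termination\<close>

lemma head_context_step:
  assumes "contract r r'"
  shows "step_trm (fill_ht H r) (fill_ht H r')" "step_cmd (fill_hc C r) (fill_hc C r')"
proof (induction H and C)
  case (HHole ts)
  have "step_trm (foldl App r ts) (foldl App r' ts)"
    by (induction ts rule: rev_induct)
      (auto intro: assms step_trm_step_cmd.intros)
  then show ?case by simp
qed (auto intro: step_trm_step_cmd.intros)

lemma head_step_imp_step: "head_step ob ob' \<Longrightarrow> step ob ob'"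
proof (induction rule: head_step.induct)
  case (1 r r' H)
  then show ?case using head_context_step by (cases H) (auto intro: step.intros)
qed

text \<open>By contraposition: an object that is not head-normalizing has a head step by progress,
  and its contractum is not head-normalizing either. Iterating gives an infinite head
  reduction.\<close>

lemma terminates_imp_head_normalizing:
  assumes "head_strategy_terminates ob"
  shows "head_normalizing ob"
proof (rule ccontr)
  assume "\<not> head_normalizing ob"
  have "\<exists>y. \<not> head_normalizing y \<and> head_step x y" if "\<not> head_normalizing x" for x
  proof -
    from that have "\<not> head_normal x" by (auto simp: head_normalizing_def)
    with head_progress obtain y where "head_step x y" by blast
    with that show ?thesis
      by (metis head_normalizing_def head_step_imp_step converse_rtranclp_into_rtranclp)
  qed
  \<comment> \<open>The invariant includes the condition for \<open>n = 0\<close> to make the chosen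
    sequence start at \<open>ob\<close>.\<close>
  then have "\<exists>f. \<forall>n. (\<not> head_normalizing (f n) \<and> (n = 0 \<longrightarrow> f n = ob)) \<and> head_step (f n) (f (Suc n))"
    using \<open>\<not> head_normalizing ob\<close>
    by (intro dependent_nat_choice) auto
  with assms show False unfolding head_strategy_terminates_def by blast
qed

lemma head_normalizing_derives_obj:
  assumes "head_normalizing ob"
  shows "\<exists>A E. derives_obj ob A E"
proof -
  from assms obtain ob' where "step\<^sup>*\<^sup>* ob ob'" "head_normal ob'"
    unfolding head_normalizing_def by blast
  then show ?thesis
    by (induction rule: converse_rtranclp_induct) (use head_normal_derives_obj step_derives_obj in blast)+
qed

lemma derives_obj_terminates:
  assumes "derives_obj ob A E"
  shows "head_strategy_terminates ob"
  unfolding head_strategy_terminates_def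
proof
  assume "\<exists>f. f 0 = ob \<and> (\<forall>i. head_step (f i) (f (Suc i)))"
  then obtain f where f: "f 0 = ob" "\<And>i. head_step (f i) (f (Suc i))" by blast
  have "(head_step ^^ m) ob (f m)" for m
    by (induction m) (use f in auto)
  then show False using head_step_power_le[OF _ assms] not_less_eq_eq by blast
qed

section \<open>Equivalence of the two presentations\<close>

lemma indexed_mset:
  obtains K :: "nat set" and f where "finite K" "M = image_mset f (mset_set K)"
proof -
  obtain xs where "mset xs = M" using ex_mset by blast
  \<comment> \<open>List positions provide the natural-number index set demanded by the typing
    rules.\<close>
  then have "M = image_mset ((!) xs) (mset_set {0..<length xs})"
    by (metis map_nth mset_map mset_upt)
  then show thesis using that by blast
qed

lemma gather_mset_set:
  assumes "finite K" "\<And>k. k \<in> K \<Longrightarrow> P (U k) (\<Gamma> k, \<Delta> k, n k)"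
  shows "gather P (image_mset U (mset_set K))
    (\<lambda>x. \<Sum>k\<in>K. \<Gamma> k x, \<lambda>a. \<Sum>k\<in>K. \<Delta> k a, \<Sum>k\<in>K. n k)"
  using assms
proof (induction K rule: finite_induct)
  case empty
  then show ?case by (simp add: zero_prod_def zero_fun_def)
next
  case (insert k K)
  then have "gather P (add_mset (U k) (image_mset U (mset_set K)))
    ((\<Gamma> k, \<Delta> k, n k) + (\<lambda>x. \<Sum>k\<in>K. \<Gamma> k x, \<lambda>a. \<Sum>k\<in>K. \<Delta> k a, \<Sum>k\<in>K. n k))"
    by (intro gather.gather_add) auto
  then show ?case using insert by (simp add: plus_fun_def)
qed

text \<open>Only an inequality holds in general: axioms and binders are charged in
  \<open>regular\<close> but free in \<open>derives\<close>. Commands and applications add the same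
  amount on both sides.\<close>

lemma regular_derives_obj:
  "regular \<Gamma> ob A \<Delta> n \<Longrightarrow> \<exists>m \<le> n. derives_obj ob A (\<Gamma>, \<Delta>, m)"
  "auxiliary \<Gamma> t I \<Delta> n \<Longrightarrow> \<exists>m \<le> n. gather (derives t) I (\<Gamma>, \<Delta>, m)"
proof (induction rule: regular_auxiliary.inducts)
  case (ax U x)
  have "(\<lambda>_. {#})(x := {#U#}) = single x {#U#}" by (auto simp: single_def)
  then have "derives (Var x) U ((\<lambda>_. {#})(x := {#U#}), \<lambda>_. {#}, 0)"
    using ax by (simp add: zero_fun_def)
  then show ?case by (force simp: derives_obj_def)
next
  case (arrow_intro \<Gamma> t U \<Delta> n)
  then obtain m where "m \<le> n" "derives t U (\<Gamma>, \<Delta>, m)" by (auto simp: derives_obj_def)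
  moreover have "(\<Gamma>, \<Delta>, m) = push_var (\<Gamma> 0) (\<lambda>x. \<Gamma> (Suc x), \<Delta>, m)"
    by (auto simp: push_var_def fun_eq_iff split: nat.split)
  ultimately have "derives (Lam t) {#Arrow (\<Gamma> 0) U#} (\<lambda>x. \<Gamma> (Suc x), \<Delta>, m)" by simp
  with \<open>m \<le> n\<close> show ?case by (intro exI[of _ m]) (simp add: derives_obj_def)
next
  case (hash_intro \<Gamma> t U \<Delta> n a)
  then obtain m where *: "m \<le> n" "derives t U (\<Gamma>, \<Delta>, m)" by (auto simp: derives_obj_def)
  have "(\<Gamma>, \<Delta>(a := \<Delta> a + U), m + arity U) = (\<Gamma>, \<Delta>, m) + label a U (arity U)"
    by (auto simp: label_def single_def fun_eq_iff)
  with * have "derives_cmd (Named a t) (\<Gamma>, \<Delta>(a := \<Delta> a + U), m + arity U)"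
    by (auto intro: combineI)
  then have "derives_obj (Command (Named a t)) Hash (\<Gamma>, \<Delta>(a := \<Delta> a + U), m + arity U)"
    unfolding derives_obj_def obj.case by blast
  with \<open>m \<le> n\<close> show ?case by (intro exI[of _ "m + arity U"] conjI add_right_mono)
next
  case (hash_elim \<Gamma> c \<Delta> n V)
  then obtain m where "m \<le> n" "derives_cmd c (\<Gamma>, \<Delta>, m)" by (auto simp: derives_obj_def)
  moreover have "(\<Gamma>, \<Delta>, m) = push_name (\<Delta> 0) (\<Gamma>, \<lambda>a. \<Delta> (Suc a), m)"
    by (auto simp: push_name_def fun_eq_iff split: nat.split)
  ultimately have "derives (Mu c) V (\<Gamma>, \<lambda>a. \<Delta> (Suc a), m)" using hash_elim by auto
  with \<open>m \<le> n\<close> show ?case by (intro exI[of _ m]) (simp add: derives_obj_def)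
next
  case (wedge K \<Gamma> t U \<Delta> n)
  then have "\<forall>k\<in>K. \<exists>m \<le> n k. derives t (U k) (\<Gamma> k, \<Delta> k, m)" by (simp add: derives_obj_def)
  then obtain m where "\<And>k. k \<in> K \<Longrightarrow> m k \<le> n k \<and> derives t (U k) (\<Gamma> k, \<Delta> k, m k)" by metis
  then show ?case using wedge(1)
    by (intro exI[of _ "\<Sum>k\<in>K. m k"] conjI gather_mset_set sum_mono) auto
next
  case (arrow_elim K \<Gamma>\<^sub>t t I U \<Delta>\<^sub>t n \<Gamma>\<^sub>u u \<Delta>\<^sub>u m)
  define M where "M = image_mset (\<lambda>k. (I k, U k)) (mset_set K)"
  have M: "arrows M = image_mset (\<lambda>k. Arrow (I k) (U k)) (mset_set K)"
    "sources M = (\<Sum>k\<in>K. I k)" "targets M = (\<Sum>k\<in>K. U k)" "size M = card K"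
    by (simp_all add: M_def arrows_def sources_def targets_def sum_unfold_sum_mset
        image_mset.compositionality comp_def)
  from arrow_elim M obtain n' m' where *: "n' \<le> n" "derives t (arrows M) (\<Gamma>\<^sub>t, \<Delta>\<^sub>t, n')"
    "m' \<le> m" "gather (derives u) (sources M) (\<Gamma>\<^sub>u, \<Delta>\<^sub>u, m')"
    by (auto simp: derives_obj_def)
  have "derives (App t u) (targets M) ((\<Gamma>\<^sub>t, \<Delta>\<^sub>t, n') + (\<Gamma>\<^sub>u, \<Delta>\<^sub>u, m') + cost (size M))"
    unfolding derives.simps using * by (intro exI[of _ M]) (auto intro!: combineI simp del: add_Pair)
  moreover have "(\<Gamma>\<^sub>t, \<Delta>\<^sub>t, n') + (\<Gamma>\<^sub>u, \<Delta>\<^sub>u, m') + cost (size M) =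
    (\<lambda>x. \<Gamma>\<^sub>t x + \<Gamma>\<^sub>u x, \<lambda>a. \<Delta>\<^sub>t a + \<Delta>\<^sub>u a, n' + m' + card K)"
    by (simp add: cost_def fun_eq_iff M)
  ultimately show ?case using * M
    by (intro exI[of _ "n' + m' + card K"]) (simp add: derives_obj_def)
qed

lemma auxiliary_add:
  assumes "regular \<Gamma> (Term t) (UnionTy U) \<Delta> n" "auxiliary \<Gamma>' t I \<Delta>' m"
  shows "\<exists>p. auxiliary (\<Gamma> + \<Gamma>') t (add_mset U I) (\<Delta> + \<Delta>') p"
  using assms(2)
proof cases
  case (wedge K G V D l)
  \<comment> \<open>A fresh index makes room for one more premise of the \<open>wedge\<close>
    rule.\<close>
  obtain j where "j \<notin> K" using wedge(5) by (meson ex_new_if_finite infinite_UNIV_nat)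
  then have eqs: "(\<lambda>x. \<Sum>k\<in>insert j K. (G(j := \<Gamma>)) k x) = \<Gamma> + \<Gamma>'"
    "(\<lambda>a. \<Sum>k\<in>insert j K. (D(j := \<Delta>)) k a) = \<Delta> + \<Delta>'"
    "image_mset (V(j := U)) (mset_set (insert j K)) = add_mset U I"
    using wedge
    by (auto simp: fun_eq_iff intro!: sum.cong image_mset_cong)
  have "auxiliary (\<lambda>x. \<Sum>k\<in>insert j K. (G(j := \<Gamma>)) k x) t
    (image_mset (V(j := U)) (mset_set (insert j K)))
    (\<lambda>a. \<Sum>k\<in>insert j K. (D(j := \<Delta>)) k a) (\<Sum>k\<in>insert j K. (l(j := n)) k)"
    using wedge assms(1) by (intro regular_auxiliary.wedge) auto
  then show ?thesis unfolding eqs by blast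
qed

lemma gather_auxiliary:
  assumes "gather (derives t) I E"
    and "\<And>U E. derives t U E \<Longrightarrow> \<exists>n. regular (fst E) (Term t) (UnionTy U) (fst (snd E)) n"
  shows "\<exists>n. auxiliary (fst E) t I (fst (snd E)) n"
  using assms(1)
proof induction
  case gather_empty
  have "auxiliary (\<lambda>x. {#}) t {#} (\<lambda>a. {#}) 0"
    using regular_auxiliary.wedge[of "{}" "\<lambda>_ _. {#}" t "\<lambda>_. {#}" "\<lambda>_ _. {#}" "\<lambda>_. 0"] by simp
  then show ?case unfolding fst_zero snd_zero zero_fun_def by (rule exI)
next
  case (gather_add U E I F)
  then obtain n m where "regular (fst E) (Term t) (UnionTy U) (fst (snd E)) n"
    "auxiliary (fst F) t I (fst (snd F)) m"
    using assms(2) by blast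
  from auxiliary_add[OF this] show ?case unfolding fst_add snd_add .
qed

text \<open>The size is left existential because this direction serves typability only; the bound on
  head steps uses the converse.\<close>

lemma derives_regular:
  "derives t U E \<Longrightarrow> \<exists>n. regular (fst E) (Term t) (UnionTy U) (fst (snd E)) n"
  "derives_cmd c E \<Longrightarrow> \<exists>n. regular (fst E) (Command c) Hash (fst (snd E)) n"
proof (induction t and c arbitrary: U E and E)
  case (Var x)
  have "single x {#U#} = (\<lambda>_. {#})(x := {#U#})" by (auto simp: single_def)
  moreover have "regular ((\<lambda>_. {#})(x := {#U#})) (Term (Var x)) (UnionTy U) (\<lambda>_. {#}) 1"
    by (rule regular_auxiliary.ax) (use Var in auto)
  ultimately have "regular (single x {#U#}) (Term (Var x)) (UnionTy U) 0 1"
    unfolding zero_fun_def by (simp only:)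
  then show ?case using Var unfolding derives.simps by (metis fst_conv snd_conv)
next
  case (Lam t)
  then obtain I V n where "U = {#Arrow I V#}"
    "regular (case_nat I (fst E)) (Term t) (UnionTy V) (fst (snd E)) n"
    by (fastforce simp: push_var_def)
  then show ?case using regular_auxiliary.arrow_intro by fastforce
next
  case (App t u)
  then obtain M A B where *: "U = targets M" "derives t (arrows M) A"
    "gather (derives u) (sources M) B" "E = A + B + cost (size M)"
    by (auto simp: combine_def)
  obtain K :: "nat set" and f where K: "finite K" "M = image_mset f (mset_set K)"
    by (rule indexed_mset)
  then have M: "arrows M = image_mset (\<lambda>k. Arrow (fst (f k)) (snd (f k))) (mset_set K)"
    "sources M = (\<Sum>k\<in>K. fst (f k))" "targets M = (\<Sum>k\<in>K. snd (f k))"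
    by (simp_all add: arrows_def sources_def targets_def sum_unfold_sum_mset
        image_mset.compositionality comp_def)
  from App.IH(1)[OF *(2)] gather_auxiliary[OF *(3) App.IH(2)] obtain n m where
    "regular (fst A) (Term t) (UnionTy (arrows M)) (fst (snd A)) n"
    "auxiliary (fst B) u (sources M) (fst (snd B)) m" by blast
  with K(1) have "regular (\<lambda>x. fst A x + fst B x) (Term (App t u)) (UnionTy (targets M))
    (\<lambda>a. fst (snd A) a + fst (snd B) a) (n + m + card K)"
    unfolding M by (rule regular_auxiliary.arrow_elim)
  then show ?case using * by (auto simp: cost_def plus_fun_def)
next
  case (Mu c)
  then obtain V n where "choice V U"
    "regular (fst E) (Command c) Hash (case_nat V (fst (snd E))) n"
    by (fastforce simp: push_name_def)
  then show ?case using regular_auxiliary.hash_elim by fastforce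
next
  case (Named a t)
  then obtain U A where *: "derives t U A" "E = A + label a U (arity U)"
    by (auto simp: combine_def)
  with Named obtain n where
    "regular (fst A) (Term t) (UnionTy U) (fst (snd A)) n" by blast
  then have "regular (fst A) (Command (Named a t)) Hash
    ((fst (snd A))(a := fst (snd A) a + U)) (n + arity U)"
    by (rule regular_auxiliary.hash_intro)
  moreover have "(fst (snd A))(a := fst (snd A) a + U) = fst (snd E)" "fst A = fst E"
    using * by (auto simp: label_def single_def fun_eq_iff)
  ultimately show ?case by auto
qed

lemma typable_iff_derives_obj: "typable ob \<longleftrightarrow> (\<exists>A E. derives_obj ob A E)"
proof
  show "typable ob \<Longrightarrow> \<exists>A E. derives_obj ob A E"
    unfolding typable_def using regular_derives_obj(1) by blast
  show "\<exists>A E. derives_obj ob A E \<Longrightarrow> typable ob"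
    unfolding typable_def derives_obj_def using derives_regular by (cases ob) fastforce+
qed

theorem theorem4p4:
  fixes ob :: obj
  shows "(typable ob \<longleftrightarrow> head_normalizing ob)
    \<and> (head_normalizing ob \<longleftrightarrow> head_strategy_terminates ob)
    \<and> (\<forall>\<Gamma> A \<Delta> n. regular \<Gamma> ob A \<Delta> n \<longrightarrow>
          (\<forall>m ob'. (head_step ^^ m) ob ob' \<longrightarrow> m \<le> n))"
proof (intro conjI allI impI)
  \<comment> \<open>The implications form a cycle: typable objects terminate, terminating objects
    are head-normalizing, and these are typable by expansion.\<close>
  show "typable ob \<longleftrightarrow> head_normalizing ob" "head_normalizing ob \<longleftrightarrow> head_strategy_terminates ob"
    using typable_iff_derives_obj head_normalizing_derives_obj derives_obj_terminates
      terminates_imp_head_normalizing by blast+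
next
  fix \<Gamma> A \<Delta> n m ob'
  assume "regular \<Gamma> ob A \<Delta> n" and steps: "(head_step ^^ m) ob ob'"
  then obtain k where "k \<le> n" "derives_obj ob A (\<Gamma>, \<Delta>, k)" using regular_derives_obj(1) by blast
  with head_step_power_le[OF steps] show "m \<le> n" by fastforce
qed

end
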